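(* Let $\Gamma$ be a metric graph with model $(G,\ell)$, $G=(V,E)$ a finite connected graph, and let $\mathscr{D}$ be a linear equivalence class of divisors of degree $d$ on $\Gamma$. Let $\Lambda\subseteq\mathbb{R}$ be an additive subgroup containing all the edge lengths $\ell_e$, $e\in E$. If the set $\mathscr{D}_\Lambda$ of $\Lambda$-rational divisors in $\mathscr{D}$ is nonempty and $\Lambda$ is dense in $\mathbb{R}$, then the set of semistability polytopes $\mathbf{P}_D$, for $D$ ranging over the $G$-admissible divisors in $\mathscr{D}_\Lambda$, gives a tiling of $H_d=\{q\in\mathbb{R}^V:\sum_{v}q(v)=d\}$ that does not depend on the choice of $\Lambda$.
   Context: Model: $\ell\colon E\to(0,+\infty)$ is an edge length function and $\Gamma$ is obtained from $G$ by replacing each edge $e$ by an interval of length $\ell_e$. A divisor is a finite formal sum $D=\sum_{x\in\Gamma}D(x)(x)$, $D(x)\in\mathbb{Z}$, of degree $\sum_xD(x)$. A rational function on $\Gamma$ is a continuous function whose restriction to each edge is piecewise affine with integral slopes; $\mathrm{div}(f)=\sum_x\mathrm{ord}_x(f)(x)$, with $\mathrm{ord}_x(f)$ the sum of incoming slopes of $f$ at $x$. Two divisors are linearly equivalent if their difference is $\mathrm{div}(f)$ for a rational function $f$. A divisor $D$ is $\Lambda$-rational if every point of its support has distances (along the edge containing it) to the extremities of that edge in $\Lambda$. It is $G$-admissible if for each edge $e$ of $G$, $D$ vanishes at every point of the interior of $e$ with at most one exception $x$, for which $D(x)=1$. For $I\subseteq V$, $I^c=V\setminus I$, $q(I)=\sum_{v\in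 I}q(v)$, $\Gamma_I$ is the union of $I$ and all edges with both extremities in $I$, $\deg(D_I)=\sum_{x\in\Gamma_I}D(x)$, and $e(I,I^c)$ is the number of edges of $G$ joining $I$ to $I^c$. The semistability polytope of a $G$-admissible divisor $D$ of degree $d$ is $\mathbf{P}_D:=\{q\in H_d:|\deg(D_I)-q(I)|\le\tfrac12e(I,I^c)\text{ for each }\emptyset\subsetneq I\subsetneq V\}$. A collection of polytopes gives a tiling of a set $S$ if their union is $S$ and any two of them are either disjoint or intersect in a common face. Independence of $\Lambda$ means that the resulting set of polytopes is the same for every $\Lambda$ satisfying the hypotheses. *)

theory Defs
  imports "HOL-Analysis.Analysis" "Graph_Theory.Digraph_Component"
begin

text \<open>
  The finite graph \<open>G\<close> (loops and multiple edges allowed) is given with an arbitrary orientation,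
  which only serves to parametrize each edge \<open>e\<close> by \<open>[0, len e]\<close>, running from \<open>tail G e\<close> to
  \<open>head G e\<close>. The vertex set is all of the finite type \<open>'v\<close>, so that the library type
  \<open>real ^ 'v\<close> is the space of real vectors indexed by the vertices.
\<close>

definition metric_graph_model :: "('v::finite, 'e) pre_digraph \<Rightarrow> ('e \<Rightarrow> real) \<Rightarrow> bool" where
  "metric_graph_model G len \<longleftrightarrow>
     fin_digraph G \<and> verts G = UNIV \<and> Digraph_Component.connected G \<and> (\<forall>e\<in>arcs G. 0 < len e)"

datatype ('v, 'e) point = Vertex 'v | Interior 'e real

definition edge_point :: "('v, 'e) pre_digraph \<Rightarrow> ('e \<Rightarrow> real) \<Rightarrow> 'e \<Rightarrow> real \<Rightarrow> ('v, 'e) point" where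
  "edge_point G len e t =
     (if t = 0 then Vertex (tail G e)
      else if t = len e then Vertex (head G e)
      else Interior e t)"

definition metric_graph :: "('v, 'e) pre_digraph \<Rightarrow> ('e \<Rightarrow> real) \<Rightarrow> ('v, 'e) point set" where
  "metric_graph G len =
     Vertex ` verts G \<union> {Interior e t | e t. e \<in> arcs G \<and> 0 < t \<and> t < len e}"


subsection \<open>Divisors and linear equivalence\<close>

definition supp :: "('p \<Rightarrow> int) \<Rightarrow> 'p set" where
  "supp D = {x. D x \<noteq> 0}"

definition divisors :: "('v, 'e) pre_digraph \<Rightarrow> ('e \<Rightarrow> real) \<Rightarrow> (('v, 'e) point \<Rightarrow> int) set" where
  "divisors G len = {D. finite (supp D) \<and> supp D \<subseteq> metric_graph G len}"

definition deg_on :: "('p \<Rightarrow> int) \<Rightarrow> 'p set \<Rightarrow> int" where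
  "deg_on D S = (\<Sum>x\<in>S \<inter> supp D. D x)"

definition degree :: "('p \<Rightarrow> int) \<Rightarrow> int" where
  "degree D = deg_on D UNIV"

definition piecewise_affine_int :: "real \<Rightarrow> (real \<Rightarrow> real) \<Rightarrow> bool" where
  "piecewise_affine_int L g \<longleftrightarrow>
     (\<exists>B. finite B \<and>
       (\<forall>a b. 0 \<le> a \<and> a < b \<and> b \<le> L \<and> {a<..<b} \<inter> B = {} \<longrightarrow>
         (\<exists>(m::int) c. \<forall>t\<in>{a<..<b}. g t = of_int m * t + c)))"

text \<open>
  Since the metric graph carries the quotient topology of the glued edges, a function on it is
  continuous iff its pullback to each closed edge is. Values of \<open>f\<close> outside the metric graph
  are irrelevant.
\<close>

definition rational_function ::
  "('v, 'e) pre_digraph \<Rightarrow> ('e \<Rightarrow> real) \<Rightarrow> (('v, 'e) point \<Rightarrow> real) \<Rightarrow> bool" where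
  "rational_function G len f \<longleftrightarrow>
     (\<forall>e\<in>arcs G. continuous_on {0..len e} (\<lambda>t. f (edge_point G len e t)) \<and>
                  piecewise_affine_int (len e) (\<lambda>t. f (edge_point G len e t)))"

text \<open>One-sided slopes with respect to increasing parameter.\<close>

definition left_slope :: "(real \<Rightarrow> real) \<Rightarrow> real \<Rightarrow> int" where
  "left_slope g t = (THE m. (g has_real_derivative of_int m) (at_left t))"

definition right_slope :: "(real \<Rightarrow> real) \<Rightarrow> real \<Rightarrow> int" where
  "right_slope g t = (THE m. (g has_real_derivative of_int m) (at_right t))"

text \<open>
  The slope of \<open>f\<close> incoming at a point along a direction is the slope of \<open>f\<close> when moving towards
  the point, whence the sign of the right slopes. A loop contributes two directions to its vertex.
\<close>

fun ord_at ::
  "('v, 'e) pre_digraph \<Rightarrow> ('e \<Rightarrow> real) \<Rightarrow> (('v, 'e) point \<Rightarrow> real) \<Rightarrow> ('v, 'e) point \<Rightarrow> int" where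
  "ord_at G len f (Vertex v) =
     (\<Sum>e\<in>in_arcs G v. left_slope (\<lambda>t. f (edge_point G len e t)) (len e))
     - (\<Sum>e\<in>out_arcs G v. right_slope (\<lambda>t. f (edge_point G len e t)) 0)"
| "ord_at G len f (Interior e s) =
     left_slope (\<lambda>t. f (edge_point G len e t)) s
     - right_slope (\<lambda>t. f (edge_point G len e t)) s"

definition div_of ::
  "('v, 'e) pre_digraph \<Rightarrow> ('e \<Rightarrow> real) \<Rightarrow> (('v, 'e) point \<Rightarrow> real) \<Rightarrow> ('v, 'e) point \<Rightarrow> int" where
  "div_of G len f x = (if x \<in> metric_graph G len then ord_at G len f x else 0)"

definition lin_equiv ::
  "('v, 'e) pre_digraph \<Rightarrow> ('e \<Rightarrow> real) \<Rightarrow>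
     ((('v, 'e) point \<Rightarrow> int) \<times> (('v, 'e) point \<Rightarrow> int)) set" where
  "lin_equiv G len =
     {(D, D'). D \<in> divisors G len \<and> D' \<in> divisors G len \<and>
        (\<exists>f. rational_function G len f \<and> (\<forall>x. D x - D' x = div_of G len f x))}"


subsection \<open>Rationality and admissibility\<close>

definition real_add_subgroup :: "real set \<Rightarrow> bool" where
  "real_add_subgroup \<Lambda> \<longleftrightarrow> 0 \<in> \<Lambda> \<and> (\<forall>x\<in>\<Lambda>. \<forall>y\<in>\<Lambda>. x + y \<in> \<Lambda>) \<and> (\<forall>x\<in>\<Lambda>. - x \<in> \<Lambda>)"

text \<open>
  For a vertex in the support the condition ranges over all edges containing it.
\<close>

definition rational_over ::
  "('v, 'e) pre_digraph \<Rightarrow> ('e \<Rightarrow> real) \<Rightarrow> real set \<Rightarrow> (('v, 'e) point \<Rightarrow> int) \<Rightarrow> bool" where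
  "rational_over G len \<Lambda> D \<longleftrightarrow>
     (\<forall>e\<in>arcs G. \<forall>t\<in>{0..len e}. edge_point G len e t \<in> supp D \<longrightarrow> t \<in> \<Lambda> \<and> len e - t \<in> \<Lambda>)"

definition G_admissible ::
  "('v, 'e) pre_digraph \<Rightarrow> ('e \<Rightarrow> real) \<Rightarrow> (('v, 'e) point \<Rightarrow> int) \<Rightarrow> bool" where
  "G_admissible G len D \<longleftrightarrow>
     (\<forall>e\<in>arcs G.
        (\<forall>t\<in>{0<..<len e}. D (Interior e t) = 0) \<or>
        (\<exists>s\<in>{0<..<len e}. D (Interior e s) = 1 \<and>
           (\<forall>t\<in>{0<..<len e}. t \<noteq> s \<longrightarrow> D (Interior e t) = 0)))"


subsection \<open>Semistability polytopes and tilings\<close>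

definition hyperplane_deg :: "int \<Rightarrow> (real ^ 'v::finite) set" where
  "hyperplane_deg d = {q. (\<Sum>v\<in>UNIV. q $ v) = of_int d}"

definition sub_metric_graph ::
  "('v, 'e) pre_digraph \<Rightarrow> ('e \<Rightarrow> real) \<Rightarrow> 'v set \<Rightarrow> ('v, 'e) point set" where
  "sub_metric_graph G len I =
     Vertex ` I \<union>
     {edge_point G len e t | e t.
        e \<in> arcs G \<and> tail G e \<in> I \<and> head G e \<in> I \<and> 0 \<le> t \<and> t \<le> len e}"

definition num_edges_between :: "('v, 'e) pre_digraph \<Rightarrow> 'v set \<Rightarrow> 'v set \<Rightarrow> nat" where
  "num_edges_between G I J =
     card {e \<in> arcs G. (tail G e \<in> I \<and> head G e \<in> J) \<or> (tail G e \<in> J \<and> head G e \<in> I)}"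

definition semistability_polytope ::
  "('v::finite, 'e) pre_digraph \<Rightarrow> ('e \<Rightarrow> real) \<Rightarrow> (('v, 'e) point \<Rightarrow> int) \<Rightarrow> (real ^ 'v) set" where
  "semistability_polytope G len D =
     {q \<in> hyperplane_deg (degree D).
        \<forall>I. I \<noteq> {} \<and> I \<noteq> UNIV \<longrightarrow>
          \<bar>of_int (deg_on D (sub_metric_graph G len I)) - (\<Sum>v\<in>I. q $ v)\<bar>
            \<le> real (num_edges_between G I (- I)) / 2}"

definition semistability_polytopes ::
  "('v::finite, 'e) pre_digraph \<Rightarrow> ('e \<Rightarrow> real) \<Rightarrow> (('v, 'e) point \<Rightarrow> int) set \<Rightarrow> real set
     \<Rightarrow> (real ^ 'v) set set" where
  "semistability_polytopes G len \<D> \<Lambda> =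
     semistability_polytope G len ` {D \<in> \<D>. rational_over G len \<Lambda> D \<and> G_admissible G len D}"

definition polytope_tiling :: "'a::euclidean_space set set \<Rightarrow> 'a set \<Rightarrow> bool" where
  "polytope_tiling \<P> S \<longleftrightarrow>
     (\<forall>P\<in>\<P>. polytope P) \<and> \<Union>\<P> = S \<and>
     (\<forall>P\<in>\<P>. \<forall>Q\<in>\<P>. P \<inter> Q = {} \<or> (P \<inter> Q face_of P \<and> P \<inter> Q face_of Q))"

end

theory Submission
  imports Defs
begin

text \<open>
  Fix a divisor \<open>D\<close> of the class. Every other divisor of the class is \<open>D - div f\<close> for a rational
  function \<open>f\<close>, and the first observation is that an \<^emph>\<open>admissible\<close> one is determined by the values
  \<open>\<phi>\<close> of \<open>f\<close> at the vertices, which can moreover be prescribed arbitrarily. Indeed, let \<open>y\<close> be the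
  mean slope that \<open>f\<close> would need on an edge once the bends forced by \<open>D\<close> are discounted. If
  \<open>y\<close> is an integer, \<open>f\<close> can keep this slope; otherwise it has to start with slope \<open>\<lfloor>y\<rfloor>\<close> and to
  increase its slope by one at a single point, whose position is dictated by the fractional part of \<open>y\<close>.
  This gives the divisors \<open>admissible_rep D \<phi>\<close>, for \<open>\<phi> \<in> \<real>\<^sup>V\<close> (lemma \<open>admissible_class_eq_range\<close>).

  The tiling is dual to the arrangement of the hyperplanes in \<open>\<real>\<^sup>V\<close> on which some mean slope is an
  integer. Let \<open>energy D\<close> be the convex function on \<open>\<real>\<^sup>V\<close> that is, up to a linear term, the sum over
  the edges of \<open>len e\<close> times a primitive of the staircase function evaluated at the mean slope. The
  derivative of \<open>\<phi> \<mapsto> energy D \<phi> + q \<bullet> \<phi>\<close> at \<open>\<phi>\<close> in the direction \<open>h\<close> is an explicit \<open>cut_form\<close>. For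
  \<open>h\<close> the indicator vector of \<open>I\<close> it is nonnegative exactly if \<open>q\<close> satisfies the upper inequality of
  the complement of \<open>I\<close> in the definition of the semistability polytope; and since cut forms are additive
  along the decomposition of \<open>h\<close> into its nested superlevel sets, nonnegativity on indicator vectors
  implies nonnegativity for all \<open>h\<close>. By convexity, \<open>q\<close> lies in the polytope of
  \<open>admissible_rep D \<phi>\<close> if and only if \<open>\<phi>\<close> minimizes \<open>energy D \<phi> + q \<bullet> \<phi>\<close> (lemma
  \<open>mem_semistability_polytope_iff_minimal\<close>).

  Everything follows from this. The polytopes cover the hyperplane because a minimizer exists: modulo
  constants the energy grows quadratically, as the graph is connected. Two of them
  meet in a common face because, on the polytope of \<open>\<phi>\<close>, the difference between the values at \<open>\<psi>\<close> and at
  \<open>\<phi>\<close> is an affine function of \<open>q\<close>, is nonnegative, and vanishes exactly where \<open>\<psi>\<close> is a minimizer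
  as well. Finally the polytope of \<open>\<phi>\<close> depends only on the floors and ceilings of the mean slopes, that is
  on the cell of the arrangement containing \<open>\<phi>\<close>, and if \<open>\<Lambda>\<close> is dense then every cell contains a potential
  whose divisor is rational over \<open>\<Lambda>\<close> (lemma \<open>rational_potential_in_cell\<close>). So the set of
  polytopes is the same for all \<open>\<Lambda>\<close>, namely the one given by all \<open>\<phi> \<in> \<real>\<^sup>V\<close>.
\<close>

section \<open>Piecewise affine functions on an interval\<close>

text \<open>
  The normal form of a piecewise affine function: initial slope \<open>m\<close>, then a change of slope by \<open>J s\<close>
  at each \<open>s \<in> S\<close>. In this form both one-sided slopes and the value at the far end are explicit sums.
\<close>

definition kinked :: "int \<Rightarrow> (real \<Rightarrow> int) \<Rightarrow> real set \<Rightarrow> real \<Rightarrow> real" where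
  "kinked m J S t = of_int m * t + (\<Sum>s\<in>S. of_int (J s) * max 0 (t - s))"

lemma max_right_derivative:
  "((\<lambda>t. max 0 (t - s)) has_real_derivative (if s \<le> t then 1 else 0)) (at_right (t::real))"
proof (cases "s \<le> t")
  case True
  have "eventually (\<lambda>y. y \<in> {t<..}) (at_right t)"
    by (rule eventually_at_right_less[THEN eventually_mono]) auto
  then have "eventually (\<lambda>y. max 0 (y - s) = y - s) (at_right t)"
    by eventually_elim (use True in auto)
  moreover have "((\<lambda>y. y - s) has_real_derivative 1) (at_right t)"
    by (auto intro!: derivative_eq_intros)
  ultimately show ?thesis
    using True by (subst has_field_derivative_cong_eventually[where g = "\<lambda>y. y - s"]) auto
next
  case False
  have "eventually (\<lambda>y. y \<in> {t<..<s}) (at_right t)"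
    by (rule eventually_at_right_real) (use False in auto)
  then have "eventually (\<lambda>y. max 0 (y - s) = 0) (at_right t)"
    by eventually_elim auto
  then show ?thesis
    using False by (subst has_field_derivative_cong_eventually[where g = "\<lambda>_. 0"]) auto
qed

lemma max_left_derivative:
  "((\<lambda>t. max 0 (t - s)) has_real_derivative (if s < t then 1 else 0)) (at_left (t::real))"
proof (cases "s < t")
  case True
  have "eventually (\<lambda>y. y \<in> {s<..<t}) (at_left t)"
    by (rule eventually_at_left_real) (use True in auto)
  then have "eventually (\<lambda>y. max 0 (y - s) = y - s) (at_left t)"
    by eventually_elim auto
  moreover have "((\<lambda>y. y - s) has_real_derivative 1) (at_left t)"
    by (auto intro!: derivative_eq_intros)
  ultimately show ?thesis
    using True by (subst has_field_derivative_cong_eventually[where g = "\<lambda>y. y - s"]) auto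
next
  case False
  have "eventually (\<lambda>y. y \<in> {t-1<..<t}) (at_left t)"
    by (rule eventually_at_left_real) auto
  then have "eventually (\<lambda>y. max 0 (y - s) = 0) (at_left t)"
    by eventually_elim (use False in auto)
  then show ?thesis
    using False by (subst has_field_derivative_cong_eventually[where g = "\<lambda>_. 0"]) auto
qed

lemma kinked_right_derivative:
  assumes "finite S"
  shows "(kinked m J S has_real_derivative of_int (m + (\<Sum>s | s \<in> S \<and> s \<le> t. J s))) (at_right t)"
proof -
  have "((\<lambda>t. of_int m * t + (\<Sum>s\<in>S. of_int (J s) * max 0 (t - s))) has_real_derivative
      of_int m * 1 + (\<Sum>s\<in>S. of_int (J s) * (if s \<le> t then 1 else 0))) (at_right t)"
    by (intro DERIV_add DERIV_cmult DERIV_sum max_right_derivative DERIV_ident)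
  moreover have "(\<Sum>s\<in>S. of_int (J s) * (if s \<le> t then 1 else (0::real)))
      = of_int (\<Sum>s | s \<in> S \<and> s \<le> t. J s)"
    using assms by (simp add: sum.inter_filter if_distrib cong: if_cong)
  ultimately show ?thesis by (simp add: kinked_def[abs_def])
qed

lemma kinked_left_derivative:
  assumes "finite S"
  shows "(kinked m J S has_real_derivative of_int (m + (\<Sum>s | s \<in> S \<and> s < t. J s))) (at_left t)"
proof -
  have "((\<lambda>t. of_int m * t + (\<Sum>s\<in>S. of_int (J s) * max 0 (t - s))) has_real_derivative
      of_int m * 1 + (\<Sum>s\<in>S. of_int (J s) * (if s < t then 1 else 0))) (at_left t)"
    by (intro DERIV_add DERIV_cmult DERIV_sum max_left_derivative DERIV_ident)
  moreover have "(\<Sum>s\<in>S. of_int (J s) * (if s < t then 1 else (0::real)))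
      = of_int (\<Sum>s | s \<in> S \<and> s < t. J s)"
    using assms by (simp add: sum.inter_filter if_distrib cong: if_cong)
  ultimately show ?thesis by (simp add: kinked_def[abs_def])
qed

lemma right_slope_eqI:
  assumes "(g has_real_derivative of_int m) (at_right t)"
  shows "right_slope g t = m"
  unfolding right_slope_def
proof (rule the_equality, rule assms)
  fix k :: int assume "(g has_real_derivative of_int k) (at_right t)"
  then have "(of_int k :: real) = of_int m"
    using assms by (intro tendsto_unique[of "at_right t" "\<lambda>y. (g y - g t) / (y - t)"])
      (auto simp: has_field_derivative_iff)
  then show "k = m" by simp
qed

lemma left_slope_eqI:
  assumes "(g has_real_derivative of_int m) (at_left t)"
  shows "left_slope g t = m"
  unfolding left_slope_def
proof (rule the_equality, rule assms)
  fix k :: int assume "(g has_real_derivative of_int k) (at_left t)"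
  then have "(of_int k :: real) = of_int m"
    using assms by (intro tendsto_unique[of "at_left t" "\<lambda>y. (g y - g t) / (y - t)"])
      (auto simp: has_field_derivative_iff)
  then show "k = m" by simp
qed

lemma right_slope_kinked:
  assumes "finite S" and g: "\<forall>t\<in>{0..L}. g t = c + kinked m J S t" and t: "0 \<le> t" "t < L"
  shows "right_slope g t = m + (\<Sum>s | s \<in> S \<and> s \<le> t. J s)"
proof (rule right_slope_eqI)
  have "eventually (\<lambda>y. y \<in> {t<..<L}) (at_right t)"
    by (rule eventually_at_right_real) (use t in auto)
  then have "eventually (\<lambda>y. g y = c + kinked m J S y) (at_right t)"
    by eventually_elim (use g t in auto)
  moreover have "((\<lambda>y. c + kinked m J S y) has_real_derivative
      0 + of_int (m + (\<Sum>s | s \<in> S \<and> s \<le> t. J s))) (at_right t)"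
    by (intro DERIV_add kinked_right_derivative assms DERIV_const)
  ultimately show "(g has_real_derivative of_int (m + (\<Sum>s | s \<in> S \<and> s \<le> t. J s))) (at_right t)"
    using g t by (subst has_field_derivative_cong_eventually[where g = "\<lambda>y. c + kinked m J S y"]) auto
qed

lemma left_slope_kinked:
  assumes "finite S" and g: "\<forall>t\<in>{0..L}. g t = c + kinked m J S t" and t: "0 < t" "t \<le> L"
  shows "left_slope g t = m + (\<Sum>s | s \<in> S \<and> s < t. J s)"
proof (rule left_slope_eqI)
  have "eventually (\<lambda>y. y \<in> {0<..<t}) (at_left t)"
    by (rule eventually_at_left_real) (use t in auto)
  then have "eventually (\<lambda>y. g y = c + kinked m J S y) (at_left t)"
    by eventually_elim (use g t in auto)
  moreover have "((\<lambda>y. c + kinked m J S y) has_real_derivative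
      0 + of_int (m + (\<Sum>s | s \<in> S \<and> s < t. J s))) (at_left t)"
    by (intro DERIV_add kinked_left_derivative assms DERIV_const)
  ultimately show "(g has_real_derivative of_int (m + (\<Sum>s | s \<in> S \<and> s < t. J s))) (at_left t)"
    using g t by (subst has_field_derivative_cong_eventually[where g = "\<lambda>y. c + kinked m J S y"]) auto
qed

lemma slope_jump_kinked:
  assumes "finite S" and "\<forall>t\<in>{0..L}. g t = c + kinked m J S t" and "0 < t" "t < L"
  shows "right_slope g t - left_slope g t = (if t \<in> S then J t else 0)"
proof -
  have "{s. s \<in> S \<and> s \<le> t} = {s. s \<in> S \<and> s < t} \<union> (if t \<in> S then {t} else {})"
    by (auto simp: order.order_iff_strict)
  then show ?thesis
    using assms by (simp add: right_slope_kinked left_slope_kinked)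
qed

lemma piecewise_affine_int_kinked:
  assumes "finite S" and g: "\<forall>t\<in>{0..L}. g t = c + kinked m J S t"
  shows "continuous_on {0..L} g" and "piecewise_affine_int L g"
proof -
  have "continuous_on {0..L} (\<lambda>t. c + kinked m J S t)"
    unfolding kinked_def by (intro continuous_intros)
  then show "continuous_on {0..L} g"
    using g by (subst continuous_on_cong[OF refl]) auto
  show "piecewise_affine_int L g"
    unfolding piecewise_affine_int_def
  proof (intro exI[of _ S] conjI allI impI assms(1))
    fix a b :: real
    assume ab: "0 \<le> a \<and> a < b \<and> b \<le> L \<and> {a<..<b} \<inter> S = {}"
    define T where "T = {s \<in> S. s \<le> a}"
    have "g t = of_int (m + (\<Sum>s\<in>T. J s)) * t + (c - (\<Sum>s\<in>T. of_int (J s) * s))"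
      if t: "t \<in> {a<..<b}" for t
    proof -
      have "max 0 (t - s) = (if s \<le> a then t - s else 0)" if "s \<in> S" for s
      proof -
        have "s \<le> a \<or> b \<le> s" using that ab by force
        then show ?thesis using t by (auto simp: max_def)
      qed
      then have "(\<Sum>s\<in>S. of_int (J s) * max 0 (t - s))
          = (\<Sum>s\<in>S. if s \<le> a then of_int (J s) * (t - s) else 0)"
        by (intro sum.cong) auto
      also have "\<dots> = (\<Sum>s\<in>T. of_int (J s) * (t - s))"
        unfolding T_def using assms(1) by (simp add: sum.inter_filter)
      also have "\<dots> = of_int (\<Sum>s\<in>T. J s) * t - (\<Sum>s\<in>T. of_int (J s) * s)"
        by (simp add: algebra_simps sum_subtractf sum_distrib_left)
      finally show ?thesis
        using g t ab by (auto simp: kinked_def algebra_simps)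
    qed
    then show "\<exists>(k::int) r. \<forall>t\<in>{a<..<b}. g t = of_int k * t + r" by blast
  qed
qed

text \<open>
  Affinity is only demanded on open subintervals; continuity carries it to the breakpoints.
\<close>

lemma affine_on_closure:
  fixes g :: "real \<Rightarrow> real"
  assumes "continuous_on {a..b} g" "a < b" "\<forall>t\<in>{a<..<b}. g t = m * t + c" "t \<in> {a..b}"
  shows "g t = m * t + c"
proof -
  have cl: "closure {a<..<b} = {a..b}" using \<open>a < b\<close> by simp
  have 1: "continuous_on (closure {a<..<b}) (\<lambda>t. g t - (m * t + c))"
    unfolding cl using assms(1) by (intro continuous_intros)
  have 2: "\<And>x. x \<in> {a<..<b} \<Longrightarrow> g x - (m * x + c) = 0"
    using assms(3) by simp
  have 3: "t \<in> closure {a<..<b}" unfolding cl by (rule assms(4))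
  have "g t - (m * t + c) = 0"
    by (rule continuous_constant_on_closure[OF 1 2 3])
  then show ?thesis by simp
qed

text \<open>
  Induction on the number of breakpoints: the last breakpoint \<open>b\<close> is removed by restricting to \<open>[0, b]\<close>,
  and then reinstated with the change from the slope there to the slope of the last affine piece.
\<close>

lemma piecewise_affine_int_imp_kinked:
  assumes "piecewise_affine_int L g" "continuous_on {0..L} g" "0 < L"
  obtains m J S where "finite S" "S \<subseteq> {0<..<L}" "\<forall>t\<in>{0..L}. g t = g 0 + kinked m J S t"
proof -
  obtain B where B: "finite B"
    "\<And>a b. 0 \<le> a \<Longrightarrow> a < b \<Longrightarrow> b \<le> L \<Longrightarrow> {a<..<b} \<inter> B = {} \<Longrightarrow>
         \<exists>(m::int) c. \<forall>t\<in>{a<..<b}. g t = of_int m * t + c"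
    using assms(1) unfolding piecewise_affine_int_def by metis
  have "\<exists>m J S. finite S \<and> S \<subseteq> {0<..<M} \<and> (\<forall>t\<in>{0..M}. g t = g 0 + kinked m J S t)"
    if "0 < M" "M \<le> L" "card (B \<inter> {0<..<M}) = n" for n M
    using that
  proof (induction n arbitrary: M rule: less_induct)
    case (less n)
    have cont: "continuous_on {a..b} g" if "0 \<le> a" "b \<le> L" for a b
      using continuous_on_subset[OF assms(2)] that by auto
    show ?case
    proof (cases "B \<inter> {0<..<M} = {}")
      case True
      then have "{0<..<M} \<inter> B = {}" by auto
      from B(2)[OF order_refl less.prems(1,2) this]
      obtain m :: int and c where mc: "\<forall>t\<in>{0<..<M}. g t = of_int m * t + c" by blast
      have "g t = of_int m * t + c" if "t \<in> {0..M}" for t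
        using affine_on_closure[OF cont[OF order_refl less.prems(2)] less.prems(1) mc that] .
      from this this[of 0] have "\<forall>t\<in>{0..M}. g t = g 0 + kinked m (\<lambda>_. 0) {} t"
        using less.prems by (simp add: kinked_def)
      then show ?thesis by blast
    next
      case False
      define b where "b = Max (B \<inter> {0<..<M})"
      have b: "b \<in> B" "0 < b" "b < M"
        using Max_in[of "B \<inter> {0<..<M}"] False B(1) unfolding b_def by auto
      have "x \<le> b" if "x \<in> B" "0 < x" "x < M" for x
        unfolding b_def by (rule Max_ge) (use that B(1) in auto)
      then have "{b<..<M} \<inter> B = {}"
        using b(2) by force
      from B(2)[OF less_imp_le[OF b(2)] b(3) less.prems(2) this]
      obtain k :: int and c where kc: "\<forall>t\<in>{b<..<M}. g t = of_int k * t + c" by blast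
      have aff: "g t = of_int k * t + c" if "t \<in> {b..M}" for t
        using affine_on_closure[OF cont[OF less_imp_le[OF b(2)] less.prems(2)] b(3) kc that] .
      have "B \<inter> {0<..<b} \<subset> B \<inter> {0<..<M}" using b by auto
      then have "card (B \<inter> {0<..<b}) < n"
        unfolding less.prems(3)[symmetric] by (intro psubset_card_mono) (use B(1) in auto)
      moreover have "b \<le> L" using b(3) less.prems(2) by linarith
      ultimately have "\<exists>m J S. finite S \<and> S \<subseteq> {0<..<b} \<and> (\<forall>t\<in>{0..b}. g t = g 0 + kinked m J S t)"
        by (intro less.IH[OF _ b(2) _ refl])
      then
      obtain m J S where S: "finite S" "S \<subseteq> {0<..<b}"
        "\<forall>t\<in>{0..b}. g t = g 0 + kinked m J S t"
        by blast
      define m' where "m' = m + (\<Sum>s\<in>S. J s)"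
      define J' where "J' = J(b := k - m')"
      have "b \<notin> S" using S by auto
      have J': "kinked m J' (insert b S) t = kinked m J S t + of_int (k - m') * max 0 (t - b)" for t
      proof -
        have "(\<Sum>s\<in>S. of_int (J' s) * max 0 (t - s)) = (\<Sum>s\<in>S. of_int (J s) * max 0 (t - s))"
          using \<open>b \<notin> S\<close> by (intro sum.cong) (auto simp: J'_def)
        then show ?thesis using \<open>b \<notin> S\<close> S by (simp add: kinked_def J'_def)
      qed
      have beyond: "kinked m J S t = kinked m J S b + of_int m' * (t - b)" if "b \<le> t" for t
      proof -
        have "(\<Sum>s\<in>S. of_int (J s) * max 0 (t - s))
          = (\<Sum>s\<in>S. of_int (J s) * max 0 (b - s) + of_int (J s) * (t - b))"
          using S that by (intro sum.cong) (auto simp: algebra_simps max_def)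
        also have "\<dots> = (\<Sum>s\<in>S. of_int (J s) * max 0 (b - s)) + of_int (\<Sum>s\<in>S. J s) * (t - b)"
          by (simp add: sum.distrib sum_distrib_right)
        finally show ?thesis
          by (simp add: kinked_def m'_def algebra_simps)
      qed
      have "g t = g 0 + kinked m J' (insert b S) t" if "t \<in> {0..M}" for t
      proof (cases "t \<le> b")
        case True
        then show ?thesis using S(3)[rule_format, of t] that by (simp add: J')
      next
        case False
        then have "g t = g b + of_int k * (t - b)"
          using aff[of t] aff[of b] that b by (simp add: algebra_simps)
        moreover have "g b = g 0 + kinked m J S b" using S(3) b(2) by (meson atLeastAtMost_iff less_imp_le order_refl)
        ultimately show ?thesis
          using False beyond[of t] by (simp add: J' algebra_simps)
      qed
      moreover have "finite (insert b S)" "insert b S \<subseteq> {0<..<M}" using S(1,2) b by auto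
      ultimately show ?thesis by blast
    qed
  qed
  then show ?thesis using that assms(3) by blast
qed

section \<open>Admissible divisors are parametrized by vertex potentials\<close>

lemma ceiling_eq_floor_add_one: "(y::real) \<notin> \<int> \<Longrightarrow> \<lceil>y\<rceil> = \<lfloor>y\<rfloor> + 1"
  by (metis Ints_of_int ceiling_altdef)

locale graph_model =
  fixes G :: "('v::finite, 'e) pre_digraph" and len :: "'e \<Rightarrow> real"
  assumes model: "metric_graph_model G len"
begin

lemma finite_arcs [simp]: "finite (arcs G)"
  using model unfolding metric_graph_model_def by (simp add: fin_digraph.finite_arcs)

lemma verts_eq [simp]: "verts G = UNIV"
  using model unfolding metric_graph_model_def by simp

lemma len_pos: "e \<in> arcs G \<Longrightarrow> 0 < len e"
  using model unfolding metric_graph_model_def by simp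

lemma finite_in_arcs [simp]: "finite (in_arcs G v)" and finite_out_arcs [simp]: "finite (out_arcs G v)"
  by (simp_all add: in_arcs_def out_arcs_def)

definition interior_support :: "(('v, 'e) point \<Rightarrow> int) \<Rightarrow> 'e \<Rightarrow> real set" where
  "interior_support D e = {s. 0 < s \<and> s < len e \<and> D (Interior e s) \<noteq> 0}"

definition edge_degree :: "(('v, 'e) point \<Rightarrow> int) \<Rightarrow> 'e \<Rightarrow> int" where
  "edge_degree D e = (\<Sum>s\<in>interior_support D e. D (Interior e s))"

text \<open>
  The increment along \<open>e\<close> of a function that starts with slope 0 and whose slope increases by
  \<open>D(s)\<close> at each interior point \<open>s\<close> of the edge.
\<close>

definition edge_moment :: "(('v, 'e) point \<Rightarrow> int) \<Rightarrow> 'e \<Rightarrow> real" where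
  "edge_moment D e = (\<Sum>s\<in>interior_support D e. of_int (D (Interior e s)) * (len e - s))"

lemma finite_interior_support:
  assumes "D \<in> divisors G len"
  shows "finite (interior_support D e)"
proof -
  have "finite (Interior e -` supp D)"
    using assms by (intro finite_vimageI) (auto simp: divisors_def inj_on_def)
  then show ?thesis
    by (rule finite_subset[rotated]) (auto simp: interior_support_def supp_def)
qed

lemma interior_support_subset: "interior_support D e \<subseteq> {0<..<len e}"
  by (auto simp: interior_support_def)

text \<open>
  Comparing two divisors needs their sums over the same finite set of points.
\<close>

lemma edge_degree_superset:
  assumes "finite S" "interior_support D e \<subseteq> S" "S \<subseteq> {0<..<len e}"
  shows "edge_degree D e = (\<Sum>s\<in>S. D (Interior e s))"
  unfolding edge_degree_def using assms
  by (intro sum.mono_neutral_left) (auto simp: interior_support_def)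

lemma edge_moment_superset:
  assumes "finite S" "interior_support D e \<subseteq> S" "S \<subseteq> {0<..<len e}"
  shows "edge_moment D e = (\<Sum>s\<in>S. of_int (D (Interior e s)) * (len e - s))"
  unfolding edge_moment_def using assms
  by (intro sum.mono_neutral_left) (auto simp: interior_support_def)

text \<open>
  The only facts about a rational function that are needed beyond its values at the vertices. Since
  \<open>D - D'\<close> is the left slope minus the right slope, the slope of \<open>f\<close> increases by \<open>D' - D\<close> when a point is
  crossed in the direction of the edge; summing the changes once gives the final slope, summing them twice gives
  the increment.
\<close>

lemma edge_slopes:
  assumes e: "e \<in> arcs G" and f: "rational_function G len f"
    and D: "D \<in> divisors G len" "D' \<in> divisors G len"
    and div: "\<And>x. D x - D' x = div_of G len f x"
  defines "g \<equiv> (\<lambda>t. f (edge_point G len e t))"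
  shows "left_slope g (len e) = right_slope g 0 + edge_degree D' e - edge_degree D e"
    and "f (Vertex (head G e)) - f (Vertex (tail G e))
           = of_int (right_slope g 0) * len e + edge_moment D' e - edge_moment D e"
proof -
  let ?L = "len e"
  have L: "0 < ?L" using e by (rule len_pos)
  have "piecewise_affine_int ?L g" "continuous_on {0..?L} g"
    using f e by (simp_all add: rational_function_def g_def)
  from piecewise_affine_int_imp_kinked[OF this L]
  obtain m J S where S: "finite S" "S \<subseteq> {0<..<?L}" and g: "\<forall>t\<in>{0..?L}. g t = g 0 + kinked m J S t" .
  \<comment> \<open>Neither set contains the other in general: \<open>J\<close> may vanish on \<open>S\<close>, and \<open>D\<close>, \<open>D'\<close> may agree at a point.\<close>
  define T where "T = S \<union> interior_support D e \<union> interior_support D' e"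
  have T: "finite T" "T \<subseteq> {0<..<?L}"
    using S D interior_support_subset by (simp_all add: T_def finite_interior_support)
  have sup: "interior_support D e \<subseteq> T" "interior_support D' e \<subseteq> T"
    by (auto simp: T_def)
  have jump: "D' (Interior e s) - D (Interior e s) = (if s \<in> S then J s else 0)" if "s \<in> {0<..<?L}" for s
  proof -
    have "D (Interior e s) - D' (Interior e s) = left_slope g s - right_slope g s"
      using div[of "Interior e s"] that e by (simp add: div_of_def metric_graph_def g_def)
    then show ?thesis
      using slope_jump_kinked[OF S(1) g, of s] that by simp
  qed
  have jumpT: "D' (Interior e s) - D (Interior e s) = (if s \<in> S then J s else 0)" if "s \<in> T" for s
    using jump subsetD[OF T(2) that] .
  have sumT: "(\<Sum>s\<in>T. h s * (if s \<in> S then of_int (J s) else 0)) = (\<Sum>s\<in>S. h s * of_int (J s))"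
    for h :: "real \<Rightarrow> 'a::comm_ring_1"
    by (rule sum.mono_neutral_cong_right) (use T S in \<open>auto simp: T_def\<close>)
  have "edge_degree D' e - edge_degree D e = (\<Sum>s\<in>T. D' (Interior e s) - D (Interior e s))"
    by (simp add: edge_degree_superset[OF T(1) sup(1) T(2)] edge_degree_superset[OF T(1) sup(2) T(2)]
        sum_subtractf)
  also have "\<dots> = (\<Sum>s\<in>T. 1 * (if s \<in> S then of_int (J s) else 0))"
    by (rule sum.cong) (simp_all add: jumpT)
  finally have deg: "edge_degree D' e - edge_degree D e = (\<Sum>s\<in>S. J s)"
    unfolding sumT by simp
  have "edge_moment D' e - edge_moment D e
      = (\<Sum>s\<in>T. of_int (D' (Interior e s)) * (?L - s) - of_int (D (Interior e s)) * (?L - s))"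
    by (simp add: edge_moment_superset[OF T(1) sup(1) T(2)] edge_moment_superset[OF T(1) sup(2) T(2)]
        sum_subtractf)
  also have "\<dots> = (\<Sum>s\<in>T. (?L - s) * of_int (D' (Interior e s) - D (Interior e s)))"
    by (simp add: algebra_simps)
  also have "\<dots> = (\<Sum>s\<in>T. (?L - s) * (if s \<in> S then of_int (J s) else 0))"
    by (rule sum.cong) (simp_all add: jumpT del: of_int_diff)
  finally have mom: "edge_moment D' e - edge_moment D e = (\<Sum>s\<in>S. (?L - s) * of_int (J s))"
    unfolding sumT .
  have "(\<Sum>s | s \<in> S \<and> s \<le> 0. J s) = 0" using S(2) by (intro sum.neutral) auto
  moreover have "(\<Sum>s | s \<in> S \<and> s < ?L. J s) = (\<Sum>s\<in>S. J s)"
    using S(2) by (intro sum.cong) auto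
  ultimately have rs: "right_slope g 0 = m" and ls: "left_slope g ?L = m + (\<Sum>s\<in>S. J s)"
    using right_slope_kinked[OF S(1) g, of 0] left_slope_kinked[OF S(1) g, of ?L] L by simp_all
  show "left_slope g ?L = right_slope g 0 + edge_degree D' e - edge_degree D e"
    using deg rs ls by simp
  have "kinked m J S ?L = of_int m * ?L + (\<Sum>s\<in>S. (?L - s) * of_int (J s))"
    unfolding kinked_def using S(2) by (intro arg_cong2[where f = "(+)"] refl sum.cong) (auto simp: max_def)
  moreover have "g ?L = g 0 + kinked m J S ?L" using g L by (meson atLeastAtMost_iff less_imp_le order_refl)
  moreover have "g 0 = f (Vertex (tail G e))" "g ?L = f (Vertex (head G e))"
    using L by (simp_all add: g_def edge_point_def)
  ultimately show "f (Vertex (head G e)) - f (Vertex (tail G e))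
           = of_int (right_slope g 0) * ?L + edge_moment D' e - edge_moment D e"
    using mom rs by simp
qed

text \<open>
  If \<open>f\<close> takes the values \<open>\<phi>\<close> at the vertices and \<open>D' = D - div f\<close>, then by the lemma \<open>edge_slopes\<close> this
  number is the initial slope of \<open>f\<close> on \<open>e\<close> plus \<open>edge_moment D' e / len e\<close>. For an admissible \<open>D'\<close> the second
  term is the fractional part.
\<close>

definition mean_slope :: "(('v, 'e) point \<Rightarrow> int) \<Rightarrow> real ^ 'v \<Rightarrow> 'e \<Rightarrow> real" where
  "mean_slope D \<phi> e = (\<phi> $ head G e - \<phi> $ tail G e + edge_moment D e) / len e"

text \<open>
  The candidate for \<open>D - div f\<close>, where \<open>f\<close> leaves the tail of each edge with slope \<open>\<lfloor>y\<rfloor>\<close>, for the mean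
  slope \<open>y\<close>, and gains one unit of slope at the point \<open>s\<close> with \<open>len e - s = len e * frac y\<close>. If \<open>y\<close> is an integer,
  this point is the head of the edge, and the condition \<open>s < len e\<close> discards it.
\<close>

definition admissible_rep :: "(('v, 'e) point \<Rightarrow> int) \<Rightarrow> real ^ 'v \<Rightarrow> ('v, 'e) point \<Rightarrow> int" where
  "admissible_rep D \<phi> x = (case x of
     Vertex v \<Rightarrow> D (Vertex v) + (\<Sum>e\<in>out_arcs G v. \<lfloor>mean_slope D \<phi> e\<rfloor>)
                   + (\<Sum>e\<in>in_arcs G v. edge_degree D e - \<lceil>mean_slope D \<phi> e\<rceil>)
   | Interior e s \<Rightarrow>
       if e \<in> arcs G \<and> s < len e \<and> s = len e * (1 - frac (mean_slope D \<phi> e)) then 1 else 0)"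

lemma admissible_rep_Vertex:
  "admissible_rep D \<phi> (Vertex v) = D (Vertex v) + (\<Sum>e\<in>out_arcs G v. \<lfloor>mean_slope D \<phi> e\<rfloor>)
                   + (\<Sum>e\<in>in_arcs G v. edge_degree D e - \<lceil>mean_slope D \<phi> e\<rceil>)"
  by (simp add: admissible_rep_def)

lemma admissible_rep_Interior:
  assumes "e \<in> arcs G"
  shows "admissible_rep D \<phi> (Interior e s)
    = (if s = len e * (1 - frac (mean_slope D \<phi> e)) \<and> mean_slope D \<phi> e \<notin> \<int> then 1 else 0)"
proof -
  have "len e * (1 - frac (mean_slope D \<phi> e)) < len e \<longleftrightarrow> mean_slope D \<phi> e \<notin> \<int>"
    using len_pos[OF assms] frac_ge_0[of "mean_slope D \<phi> e"] frac_eq_0_iff[of "mean_slope D \<phi> e"]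
    by (auto simp: algebra_simps zero_less_mult_iff)
  then show ?thesis using assms by (auto simp: admissible_rep_def)
qed

lemma interior_support_admissible_rep:
  assumes "e \<in> arcs G"
  shows "interior_support (admissible_rep D \<phi>) e
    = (if mean_slope D \<phi> e \<in> \<int> then {} else {len e * (1 - frac (mean_slope D \<phi> e))})"
proof -
  have "0 < len e * (1 - frac (mean_slope D \<phi> e))"
    using len_pos[OF assms] frac_lt_1[of "mean_slope D \<phi> e"] by simp
  moreover have "len e * (1 - frac (mean_slope D \<phi> e)) < len e" if "mean_slope D \<phi> e \<notin> \<int>"
    using that len_pos[OF assms] by (simp add: frac_gt_0_iff)
  ultimately show ?thesis
    using assms by (auto simp: interior_support_def admissible_rep_Interior)
qed

lemma edge_degree_admissible_rep:
  "e \<in> arcs G \<Longrightarrow> edge_degree (admissible_rep D \<phi>) e = \<lceil>mean_slope D \<phi> e\<rceil> - \<lfloor>mean_slope D \<phi> e\<rfloor>"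
  by (auto simp: edge_degree_def interior_support_admissible_rep admissible_rep_Interior
      ceiling_eq_floor_add_one elim: Ints_cases)

lemma edge_moment_admissible_rep:
  "e \<in> arcs G \<Longrightarrow> edge_moment (admissible_rep D \<phi>) e = len e * frac (mean_slope D \<phi> e)"
  by (auto simp: edge_moment_def interior_support_admissible_rep admissible_rep_Interior algebra_simps)

lemma admissible_rep_divisor: "admissible_rep D \<phi> \<in> divisors G len"
proof -
  let ?p = "\<lambda>e. Interior e (len e * (1 - frac (mean_slope D \<phi> e)))"
  have "x \<in> range Vertex \<union> ?p ` arcs G" if "x \<in> supp (admissible_rep D \<phi>)" for x
    using that by (cases x) (auto simp: supp_def admissible_rep_def split: if_splits)
  then have "supp (admissible_rep D \<phi>) \<subseteq> range Vertex \<union> ?p ` arcs G" by blast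
  then have "finite (supp (admissible_rep D \<phi>))"
    by (rule finite_subset) simp
  moreover have "x \<in> metric_graph G len" if "x \<in> supp (admissible_rep D \<phi>)" for x
  proof (cases x)
    case (Interior e s)
    then have "e \<in> arcs G" "s < len e" "s = len e * (1 - frac (mean_slope D \<phi> e))"
      using that by (auto simp: supp_def admissible_rep_def split: if_splits)
    moreover from this have "0 < s" using len_pos[of e] frac_lt_1[of "mean_slope D \<phi> e"] by simp
    ultimately show ?thesis using Interior by (simp add: metric_graph_def)
  qed (simp add: metric_graph_def)
  ultimately show ?thesis unfolding divisors_def by blast
qed

lemma admissible_rep_admissible: "G_admissible G len (admissible_rep D \<phi>)"
  unfolding G_admissible_def
proof
  fix e assume e: "e \<in> arcs G"
  let ?y = "mean_slope D \<phi> e"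
  show "(\<forall>t\<in>{0<..<len e}. admissible_rep D \<phi> (Interior e t) = 0) \<or>
        (\<exists>s\<in>{0<..<len e}. admissible_rep D \<phi> (Interior e s) = 1 \<and>
           (\<forall>t\<in>{0<..<len e}. t \<noteq> s \<longrightarrow> admissible_rep D \<phi> (Interior e t) = 0))"
  proof (cases "?y \<in> \<int>")
    case True
    then show ?thesis using e by (simp add: admissible_rep_Interior)
  next
    case False
    have "len e * (1 - frac ?y) \<in> interior_support (admissible_rep D \<phi>) e"
      using interior_support_admissible_rep[OF e] False by simp
    then have "len e * (1 - frac ?y) \<in> {0<..<len e}" by (simp add: interior_support_def)
    then show ?thesis
      using False e by (intro disjI2 bexI[of _ "len e * (1 - frac ?y)"]) (auto simp: admissible_rep_Interior)
  qed
qed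

text \<open>
  With at most one interior point of multiplicity one, \<open>edge_moment D' e / len e\<close> lies in \<open>[0, 1)\<close>. So the
  initial slope and the position of the point are the integral and the fractional part of the mean slope, and
  they determine \<open>D'\<close> everywhere.
\<close>

lemma admissible_eq_admissible_rep:
  assumes D: "D \<in> divisors G len" "D' \<in> divisors G len" and adm: "G_admissible G len D'"
    and f: "rational_function G len f" and div: "\<And>x. D x - D' x = div_of G len f x"
  defines "\<phi> \<equiv> (\<chi> v. f (Vertex v))"
  shows "D' = admissible_rep D \<phi>"
proof -
  define y where "y = mean_slope D \<phi>"
  have edge: "right_slope (\<lambda>t. f (edge_point G len e t)) 0 = \<lfloor>y e\<rfloor> \<and>
      left_slope (\<lambda>t. f (edge_point G len e t)) (len e) = \<lceil>y e\<rceil> - edge_degree D e \<and>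
      (\<forall>s\<in>{0<..<len e}. D' (Interior e s) = admissible_rep D \<phi> (Interior e s))"
    if e: "e \<in> arcs G" for e
  proof -
    let ?L = "len e"
    define r where "r = right_slope (\<lambda>t. f (edge_point G len e t)) 0"
    have L: "0 < ?L" using e by (rule len_pos)
    have ls: "left_slope (\<lambda>t. f (edge_point G len e t)) ?L = r + edge_degree D' e - edge_degree D e"
      and "f (Vertex (head G e)) - f (Vertex (tail G e)) = of_int r * ?L + edge_moment D' e - edge_moment D e"
      using edge_slopes[OF e f D div] by (simp_all add: r_def)
    then have y: "y e = of_int r + edge_moment D' e / ?L"
      using L by (simp add: y_def mean_slope_def \<phi>_def field_simps)
    from adm e consider (zero) "\<forall>t\<in>{0<..<?L}. D' (Interior e t) = 0"
      | (one) s where "s \<in> {0<..<?L}" "D' (Interior e s) = 1"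
          "\<forall>t\<in>{0<..<?L}. t \<noteq> s \<longrightarrow> D' (Interior e t) = 0"
      unfolding G_admissible_def by blast
    then show ?thesis
    proof cases
      case zero
      then have "interior_support D' e = {}" by (auto simp: interior_support_def)
      then have "edge_degree D' e = 0" "y e = of_int r"
        using y by (simp_all add: edge_degree_def edge_moment_def)
      then show ?thesis
        using zero ls e by (simp add: r_def[symmetric] admissible_rep_Interior y_def[symmetric])
    next
      case one
      then have "interior_support D' e = {s}" by (auto simp: interior_support_def)
      then have ed: "edge_degree D' e = 1" and "y e = of_int r + (?L - s) / ?L"
        using y one by (simp_all add: edge_degree_def edge_moment_def)
      moreover have "0 < (?L - s) / ?L" "(?L - s) / ?L < 1" using one(1) by auto
      ultimately have fl: "\<lfloor>y e\<rfloor> = r" and fr: "frac (y e) = (?L - s) / ?L"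
        by (auto simp: floor_eq_iff frac_def)
      then have nI: "y e \<notin> \<int>" using \<open>0 < (?L - s) / ?L\<close> by (metis frac_eq_0_iff less_irrefl)
      then have "\<lceil>y e\<rceil> = r + 1" using fl by (simp add: ceiling_eq_floor_add_one)
      moreover have "?L * (1 - frac (y e)) = s" using fr L by (simp add: field_simps)
      ultimately show ?thesis
        using one ls e fl ed nI by (auto simp: r_def[symmetric] admissible_rep_Interior y_def[symmetric])
    qed
  qed
  show ?thesis
  proof
    fix x
    show "D' x = admissible_rep D \<phi> x"
    proof (cases x)
      case (Vertex v)
      have "D (Vertex v) - D' (Vertex v) = div_of G len f (Vertex v)" by (rule div)
      also have "\<dots> = (\<Sum>e\<in>in_arcs G v. left_slope (\<lambda>t. f (edge_point G len e t)) (len e))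
        - (\<Sum>e\<in>out_arcs G v. right_slope (\<lambda>t. f (edge_point G len e t)) 0)"
        by (simp add: div_of_def metric_graph_def)
      also have "\<dots> = (\<Sum>e\<in>in_arcs G v. \<lceil>y e\<rceil> - edge_degree D e) - (\<Sum>e\<in>out_arcs G v. \<lfloor>y e\<rfloor>)"
        using edge by (intro arg_cong2[where f = minus] sum.cong) (auto simp: in_arcs_def out_arcs_def)
      finally show ?thesis
        by (simp add: Vertex admissible_rep_Vertex y_def sum_subtractf)
    next
      case (Interior e s)
      show ?thesis
      proof (cases "e \<in> arcs G \<and> s \<in> {0<..<len e}")
        case True
        then show ?thesis using edge Interior by blast
      next
        case False
        then have "x \<notin> metric_graph G len" using Interior by (auto simp: metric_graph_def)
        then show ?thesis
          using D(2) admissible_rep_divisor[of D \<phi>] by (force simp: divisors_def supp_def)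
      qed
    qed
  qed
qed

text \<open>
  The function is built edge by edge in kinked form with the prescribed slope changes. It takes the right value
  at the head of each edge precisely because of the position chosen for the extra point.
\<close>

lemma admissible_rep_lin_equiv:
  assumes D: "D \<in> divisors G len"
  shows "(D, admissible_rep D \<phi>) \<in> lin_equiv G len"
proof -
  define D' where "D' = admissible_rep D \<phi>"
  define y where "y = mean_slope D \<phi>"
  define S where "S = (\<lambda>e. interior_support D e \<union> interior_support D' e)"
  define J where "J = (\<lambda>e s. D' (Interior e s) - D (Interior e s))"
  define f where "f = (\<lambda>x. case x of Vertex v \<Rightarrow> \<phi> $ v
    | Interior e t \<Rightarrow> \<phi> $ tail G e + kinked \<lfloor>y e\<rfloor> (J e) (S e) t)"
  have D': "D' \<in> divisors G len" unfolding D'_def by (rule admissible_rep_divisor)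
  have S: "finite (S e)" "S e \<subseteq> {0<..<len e}" for e
    using D D' interior_support_subset by (simp_all add: S_def finite_interior_support)
  have sup: "interior_support D e \<subseteq> S e" "interior_support D' e \<subseteq> S e" for e
    by (auto simp: S_def)
  have sumJ: "(\<Sum>s\<in>S e. J e s) = edge_degree D' e - edge_degree D e" for e
    by (simp add: edge_degree_superset[OF S(1) sup(1) S(2)] edge_degree_superset[OF S(1) sup(2) S(2)]
        J_def sum_subtractf)
  have g: "\<forall>t\<in>{0..len e}. f (edge_point G len e t) = \<phi> $ tail G e + kinked \<lfloor>y e\<rfloor> (J e) (S e) t"
    if e: "e \<in> arcs G" for e
  proof -
    have L: "0 < len e" using e by (rule len_pos)
    have 0: "kinked \<lfloor>y e\<rfloor> (J e) (S e) 0 = 0"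
      using S[of e] by (auto simp: kinked_def max_def intro!: sum.neutral)
    have "(\<Sum>s\<in>S e. of_int (J e s) * max 0 (len e - s))
      = (\<Sum>s\<in>S e. of_int (D' (Interior e s)) * (len e - s) - of_int (D (Interior e s)) * (len e - s))"
      using S(2)[of e] by (intro sum.cong) (auto simp: J_def max_def algebra_simps)
    also have "\<dots> = edge_moment D' e - edge_moment D e"
      by (simp add: edge_moment_superset[OF S(1) sup(1) S(2)] edge_moment_superset[OF S(1) sup(2) S(2)]
          sum_subtractf)
    also have "edge_moment D' e = len e * frac (y e)"
      unfolding D'_def y_def by (rule edge_moment_admissible_rep[OF e])
    finally have "kinked \<lfloor>y e\<rfloor> (J e) (S e) (len e) = len e * y e - edge_moment D e"
      by (simp add: kinked_def frac_def algebra_simps)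
    then have 1: "kinked \<lfloor>y e\<rfloor> (J e) (S e) (len e) = \<phi> $ head G e - \<phi> $ tail G e"
      using L by (simp add: y_def mean_slope_def)
    show ?thesis using 0 1 by (auto simp: f_def edge_point_def)
  qed
  have "rational_function G len f"
    unfolding rational_function_def using piecewise_affine_int_kinked[OF S(1) g] by blast
  moreover have "D x - D' x = div_of G len f x" for x
  proof (cases "x \<in> metric_graph G len")
    case False
    then show ?thesis using D D' by (force simp: divisors_def supp_def div_of_def)
  next
    case True
    show ?thesis
    proof (cases x)
      case (Interior e s)
      then have e: "e \<in> arcs G" and s: "0 < s" "s < len e" using True by (auto simp: metric_graph_def)
      have "s \<notin> S e \<Longrightarrow> J e s = 0" using s by (simp add: S_def J_def interior_support_def)
      then show ?thesis
        using slope_jump_kinked[OF S(1) g[OF e] s] True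
        by (auto simp: Interior div_of_def J_def split: if_splits)
    next
      case (Vertex v)
      have rs: "right_slope (\<lambda>t. f (edge_point G len e t)) 0 = \<lfloor>y e\<rfloor>" if e: "e \<in> arcs G" for e
      proof -
        have "(\<Sum>s | s \<in> S e \<and> s \<le> 0. J e s) = 0" using S(2)[of e] by (intro sum.neutral) auto
        then show ?thesis using right_slope_kinked[OF S(1) g[OF e], of 0] len_pos[OF e] by simp
      qed
      have ls: "left_slope (\<lambda>t. f (edge_point G len e t)) (len e) = \<lceil>y e\<rceil> - edge_degree D e"
        if e: "e \<in> arcs G" for e
      proof -
        have "(\<Sum>s | s \<in> S e \<and> s < len e. J e s) = (\<Sum>s\<in>S e. J e s)"
          using S(2)[of e] by (intro sum.cong) auto
        then have "left_slope (\<lambda>t. f (edge_point G len e t)) (len e) = \<lfloor>y e\<rfloor> + (\<Sum>s\<in>S e. J e s)"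
          using left_slope_kinked[OF S(1) g[OF e], of "len e"] len_pos[OF e] by simp
        also have "\<dots> = \<lceil>y e\<rceil> - edge_degree D e"
          unfolding sumJ D'_def edge_degree_admissible_rep[OF e] by (simp add: y_def)
        finally show ?thesis .
      qed
      have "div_of G len f x = (\<Sum>e\<in>in_arcs G v. left_slope (\<lambda>t. f (edge_point G len e t)) (len e))
        - (\<Sum>e\<in>out_arcs G v. right_slope (\<lambda>t. f (edge_point G len e t)) 0)"
        by (simp add: div_of_def metric_graph_def Vertex)
      also have "\<dots> = (\<Sum>e\<in>in_arcs G v. \<lceil>y e\<rceil> - edge_degree D e) - (\<Sum>e\<in>out_arcs G v. \<lfloor>y e\<rfloor>)"
        using rs ls by (intro arg_cong2[where f = minus] sum.cong) (auto simp: in_arcs_def out_arcs_def)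
      finally show ?thesis
        by (simp add: Vertex D'_def admissible_rep_Vertex y_def sum_subtractf)
    qed
  qed
  ultimately show ?thesis
    using D D' unfolding lin_equiv_def D'_def by blast
qed

lemma admissible_class_eq_range:
  assumes "D \<in> divisors G len"
  shows "{D' \<in> lin_equiv G len `` {D}. G_admissible G len D'} = range (admissible_rep D)"
proof (intro equalityI subsetI)
  fix D' assume "D' \<in> {D' \<in> lin_equiv G len `` {D}. G_admissible G len D'}"
  then show "D' \<in> range (admissible_rep D)"
    using admissible_eq_admissible_rep by (fastforce simp: lin_equiv_def)
next
  fix D' assume "D' \<in> range (admissible_rep D)"
  then show "D' \<in> {D' \<in> lin_equiv G len `` {D}. G_admissible G len D'}"
    using admissible_rep_lin_equiv[OF assms] admissible_rep_admissible by auto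
qed

end

section \<open>A convex function whose derivative is a staircase\<close>

text \<open>
  The primitive, vanishing at 0, of the step function \<open>x \<mapsto> \<lfloor>x\<rfloor> + 1/2\<close>. It is the upper envelope of its
  tangent lines, whose slopes are the half-integers.
\<close>

definition staircase_primitive :: "real \<Rightarrow> real" where
  "staircase_primitive x = (of_int \<lfloor>x\<rfloor> + 1/2) * x - of_int \<lfloor>x\<rfloor> * (of_int \<lfloor>x\<rfloor> + 1) / 2"

lemma staircase_primitive_tangent:
  "(of_int n + 1/2) * x - of_int n * (of_int n + 1) / 2 \<le> staircase_primitive x"
proof -
  define k where "k = \<lfloor>x\<rfloor>"
  have k: "of_int k \<le> x" "x < of_int k + 1" unfolding k_def by linarith+
  have "0 \<le> (of_int k - of_int n) * (x - (of_int k + of_int n + 1) / 2)"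
  proof (cases n k rule: linorder_cases)
    case less
    then have "of_int n + 1 \<le> (of_int k :: real)" by linarith
    then show ?thesis using k by (intro mult_nonneg_nonneg) auto
  next
    case greater
    then have "of_int k + 1 \<le> (of_int n :: real)" by linarith
    then show ?thesis using k by (intro mult_nonpos_nonpos) auto
  qed simp
  then show ?thesis
    by (simp add: staircase_primitive_def k_def[symmetric] field_simps)
qed

lemma staircase_primitive_eq_tangent:
  assumes "of_int n \<le> x" "x \<le> of_int n + 1"
  shows "staircase_primitive x = (of_int n + 1/2) * x - of_int n * (of_int n + 1) / 2"
proof (cases "x = of_int n + 1")
  case True
  then have "x = of_int (n + 1)" by simp
  then have "\<lfloor>x\<rfloor> = n + 1" by (metis floor_of_int)
  then show ?thesis using True by (simp add: staircase_primitive_def field_simps)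
next
  case False
  then have "\<lfloor>x\<rfloor> = n" using assms by (simp add: floor_eq_iff)
  then show ?thesis by (simp add: staircase_primitive_def)
qed

lemma staircase_primitive_ge_square: "x\<^sup>2 / 2 \<le> staircase_primitive x"
proof -
  define k where "k = \<lfloor>x\<rfloor>"
  have k: "of_int k \<le> x" "x < of_int k + 1" unfolding k_def by linarith+
  then have "0 \<le> (x - of_int k) * (of_int k + 1 - x)" by simp
  then show ?thesis
    by (simp add: staircase_primitive_def k_def[symmetric] field_simps power2_eq_square)
qed

text \<open>
  At an integer the function has a corner with slopes \<open>x - 1/2\<close> and \<open>x + 1/2\<close>, elsewhere it is locally affine.
  Both cases are covered by one formula, since \<open>\<lceil>x\<rceil> - \<lfloor>x\<rfloor>\<close> is 0 at the integers and 1 elsewhere.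
\<close>

lemma staircase_primitive_subgradient:
  "staircase_primitive x + (of_int \<lfloor>x\<rfloor> + of_int \<lceil>x\<rceil>) / 2 * (y - x)
     + (1 - (of_int \<lceil>x\<rceil> - of_int \<lfloor>x\<rfloor>)) / 2 * \<bar>y - x\<bar> \<le> staircase_primitive y"
proof (cases "x \<in> \<int>")
  case False
  then have c: "\<lceil>x\<rceil> = \<lfloor>x\<rfloor> + 1" by (rule ceiling_eq_floor_add_one)
  show ?thesis
    using staircase_primitive_tangent[of "\<lfloor>x\<rfloor>" y] by (simp add: c staircase_primitive_def field_simps)
next
  case True
  then obtain k where x: "x = of_int k" by (elim Ints_cases)
  show ?thesis
    using staircase_primitive_tangent[of k y] staircase_primitive_tangent[of "k - 1" y]
    by (auto simp: x staircase_primitive_def field_simps abs_if)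
qed

text \<open>
  The convexity bound \<open>staircase_primitive_subgradient\<close> is attained near \<open>x\<close>. Together they identify the
  directional derivatives of the energy without differentiating.
\<close>

lemma staircase_primitive_locally_conic:
  "eventually (\<lambda>y. staircase_primitive y = staircase_primitive x + (of_int \<lfloor>x\<rfloor> + of_int \<lceil>x\<rceil>) / 2 * (y - x)
     + (1 - (of_int \<lceil>x\<rceil> - of_int \<lfloor>x\<rfloor>)) / 2 * \<bar>y - x\<bar>) (nhds x)"
proof (cases "x \<in> \<int>")
  case False
  then have c: "\<lceil>x\<rceil> = \<lfloor>x\<rfloor> + 1" by (rule ceiling_eq_floor_add_one)
  have "x \<noteq> of_int \<lfloor>x\<rfloor>" using False by (metis Ints_of_int)
  then have "of_int \<lfloor>x\<rfloor> < x" "x < of_int \<lfloor>x\<rfloor> + 1" by linarith+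
  then have "x \<in> {of_int \<lfloor>x\<rfloor><..<of_int \<lfloor>x\<rfloor> + 1}" by simp
  then have "eventually (\<lambda>y. y \<in> {of_int \<lfloor>x\<rfloor><..<of_int \<lfloor>x\<rfloor> + 1}) (nhds x)"
    by (intro eventually_nhds_in_open open_greaterThanLessThan)
  then show ?thesis
  proof eventually_elim
    case (elim y)
    then show ?case
      using staircase_primitive_eq_tangent[of "\<lfloor>x\<rfloor>" y]
      by (simp add: c staircase_primitive_def field_simps)
  qed
next
  case True
  then obtain k where x: "x = of_int k" by (elim Ints_cases)
  have "eventually (\<lambda>y. y \<in> {of_int k - 1<..<of_int k + 1}) (nhds x)"
    by (intro eventually_nhds_in_open open_greaterThanLessThan) (simp add: x)
  then show ?thesis
  proof eventually_elim
    case (elim y)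
    then show ?case
      using staircase_primitive_eq_tangent[of k y] staircase_primitive_eq_tangent[of "k - 1" y]
      by (cases "of_int k \<le> y") (simp_all add: x staircase_primitive_def field_simps abs_if)
  qed
qed

lemma isCont_staircase_primitive: "isCont staircase_primitive x"
proof -
  have "isCont (\<lambda>y. staircase_primitive x + (of_int \<lfloor>x\<rfloor> + of_int \<lceil>x\<rceil>) / 2 * (y - x)
     + (1 - (of_int \<lceil>x\<rceil> - of_int \<lfloor>x\<rfloor>)) / 2 * \<bar>y - x\<bar>) x"
    by (intro continuous_intros)
  then show ?thesis
    using isCont_cong[OF staircase_primitive_locally_conic[of x]] by simp
qed

section \<open>Semistability polytopes and cut forms\<close>

context graph_model
begin

abbreviation difference :: "real ^ 'v \<Rightarrow> 'e \<Rightarrow> real" where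
  "difference h e \<equiv> h $ head G e - h $ tail G e"

abbreviation indicator_vec :: "'v set \<Rightarrow> real ^ 'v" where
  "indicator_vec I \<equiv> (\<chi> v. indicator I v)"

lemma sum_out_arcs:
  "(\<Sum>v\<in>UNIV. (\<Sum>e\<in>out_arcs G v. w e) * h $ v) = (\<Sum>e\<in>arcs G. w e * h $ tail G e)"
  for w :: "'e \<Rightarrow> real"
proof -
  have "(\<Sum>v\<in>UNIV. (\<Sum>e\<in>out_arcs G v. w e) * h $ v)
      = (\<Sum>v\<in>UNIV. \<Sum>e | e \<in> arcs G \<and> tail G e = v. w e * h $ tail G e)"
    by (auto simp: out_arcs_def sum_distrib_right intro!: sum.cong)
  also have "\<dots> = (\<Sum>e\<in>arcs G. w e * h $ tail G e)"
    by (rule sum.group) auto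
  finally show ?thesis .
qed

lemma sum_in_arcs:
  "(\<Sum>v\<in>UNIV. (\<Sum>e\<in>in_arcs G v. w e) * h $ v) = (\<Sum>e\<in>arcs G. w e * h $ head G e)"
  for w :: "'e \<Rightarrow> real"
proof -
  have "(\<Sum>v\<in>UNIV. (\<Sum>e\<in>in_arcs G v. w e) * h $ v)
      = (\<Sum>v\<in>UNIV. \<Sum>e | e \<in> arcs G \<and> head G e = v. w e * h $ head G e)"
    by (auto simp: in_arcs_def sum_distrib_right intro!: sum.cong)
  also have "\<dots> = (\<Sum>e\<in>arcs G. w e * h $ head G e)"
    by (rule sum.group) auto
  finally show ?thesis .
qed

lemma deg_on_sub_metric_graph:
  assumes D: "D \<in> divisors G len"
  shows "of_int (deg_on D (sub_metric_graph G len I))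
    = (\<Sum>v\<in>UNIV. of_int (D (Vertex v)) * indicator I v)
      + (\<Sum>e\<in>arcs G. of_int (edge_degree D e) * (indicator I (tail G e) * indicator I (head G e) :: real))"
proof -
  define E where "E = {e \<in> arcs G. tail G e \<in> I \<and> head G e \<in> I}"
  define B where "B = (\<lambda>(e, s). Interior e s :: ('v, 'e) point) ` (SIGMA e:E. interior_support D e)"
  have fE: "finite E" by (simp add: E_def)
  have fB: "finite B" using fE D by (auto simp: B_def finite_interior_support)
  have sub: "sub_metric_graph G len I \<inter> supp D \<subseteq> Vertex ` I \<union> B"
  proof
    fix x assume x: "x \<in> sub_metric_graph G len I \<inter> supp D"
    then have "D x \<noteq> 0" by (simp add: supp_def)
    show "x \<in> Vertex ` I \<union> B"
    proof (cases x)
      case (Vertex v)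
      then show ?thesis using x by (auto simp: sub_metric_graph_def edge_point_def split: if_splits)
    next
      case (Interior e s)
      then have "e \<in> E" "0 < s" "s < len e"
        using x by (auto simp: sub_metric_graph_def edge_point_def E_def split: if_splits)
      then show ?thesis
        using Interior \<open>D x \<noteq> 0\<close> by (force simp: B_def interior_support_def)
    qed
  qed
  have "B \<subseteq> sub_metric_graph G len I"
  proof
    fix x assume "x \<in> B"
    then obtain e s where "x = Interior e s" "e \<in> E" "0 < s" "s < len e"
      by (auto simp: B_def interior_support_def)
    moreover from this have "x = edge_point G len e s" by (simp add: edge_point_def)
    ultimately show "x \<in> sub_metric_graph G len I"
      unfolding sub_metric_graph_def E_def by (auto intro!: exI[of _ e] exI[of _ s])
  qed
  moreover have "Vertex ` I \<subseteq> sub_metric_graph G len I" by (simp add: sub_metric_graph_def)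
  ultimately have zero: "D x = 0" if "x \<in> Vertex ` I \<union> B - sub_metric_graph G len I \<inter> supp D" for x
    using that by (auto simp: supp_def)
  have "deg_on D (sub_metric_graph G len I) = (\<Sum>x\<in>Vertex ` I \<union> B. D x)"
    unfolding deg_on_def using fB sub zero by (intro sum.mono_neutral_left) auto
  also have "\<dots> = (\<Sum>x\<in>Vertex ` I. D x) + (\<Sum>x\<in>B. D x)"
    using fB by (intro sum.union_disjoint) (auto simp: B_def)
  also have "(\<Sum>x\<in>Vertex ` I. D x) = (\<Sum>v\<in>I. D (Vertex v))"
    by (subst sum.reindex) (auto simp: inj_on_def)
  also have "(\<Sum>x\<in>B. D x) = (\<Sum>(e, s)\<in>(SIGMA e:E. interior_support D e). D (Interior e s))"
    unfolding B_def by (subst sum.reindex) (auto simp: inj_on_def case_prod_unfold)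
  also have "\<dots> = (\<Sum>e\<in>E. edge_degree D e)"
    unfolding edge_degree_def by (subst sum.Sigma) (auto simp: fE finite_interior_support[OF D])
  finally have "real_of_int (deg_on D (sub_metric_graph G len I))
      = (\<Sum>v\<in>I. of_int (D (Vertex v))) + (\<Sum>e\<in>E. of_int (edge_degree D e))"
    by simp
  also have "(\<Sum>v\<in>I. real_of_int (D (Vertex v))) = (\<Sum>v\<in>UNIV. of_int (D (Vertex v)) * indicator I v)"
    by (rule sum.mono_neutral_cong_left) auto
  also have "(\<Sum>e\<in>E. real_of_int (edge_degree D e))
      = (\<Sum>e\<in>arcs G. of_int (edge_degree D e) * (indicator I (tail G e) * indicator I (head G e)))"
    by (rule sum.mono_neutral_cong_left) (auto simp: E_def indicator_def)
  finally show ?thesis .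
qed

lemma degree_eq:
  assumes D: "D \<in> divisors G len"
  shows "of_int (degree D) = (\<Sum>v\<in>UNIV. real_of_int (D (Vertex v))) + (\<Sum>e\<in>arcs G. of_int (edge_degree D e))"
proof -
  have "supp D \<subseteq> sub_metric_graph G len UNIV"
  proof
    fix x assume "x \<in> supp D"
    then have "x \<in> metric_graph G len" using D by (auto simp: divisors_def)
    then show "x \<in> sub_metric_graph G len UNIV"
    proof (cases x)
      case (Interior e s)
      with \<open>x \<in> metric_graph G len\<close> have es: "e \<in> arcs G" "0 < s" "s < len e" by (auto simp: metric_graph_def)
      moreover from this have "x = edge_point G len e s" by (simp add: edge_point_def Interior)
      ultimately show ?thesis
        unfolding sub_metric_graph_def by (auto intro!: exI[of _ e] exI[of _ s])
    qed (simp add: sub_metric_graph_def)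
  qed
  then have "degree D = deg_on D (sub_metric_graph G len UNIV)"
    by (simp add: degree_def deg_on_def Int_absorb1)
  then show ?thesis using deg_on_sub_metric_graph[OF D, of UNIV] by simp
qed

lemma num_edges_between_eq:
  "real (num_edges_between G I (- I)) = (\<Sum>e\<in>arcs G. \<bar>difference (indicator_vec I) e\<bar>)"
proof -
  have "real (num_edges_between G I (- I))
     = (\<Sum>e\<in>{e \<in> arcs G. (tail G e \<in> I \<and> head G e \<in> - I) \<or> (tail G e \<in> - I \<and> head G e \<in> I)}. 1)"
    unfolding num_edges_between_def by simp
  also have "\<dots> = (\<Sum>e\<in>arcs G. \<bar>difference (indicator_vec I) e\<bar>)"
    by (rule sum.mono_neutral_cong_left) (auto simp: indicator_def)
  finally show ?thesis .
qed

text \<open>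
  For fixed \<open>D\<close> and \<open>q\<close> this is the linear form \<open>q - D\<close> in \<open>h\<close>, where the degree of \<open>D\<close> inside an edge is
  shared equally between its ends, plus a weighted total variation of \<open>h\<close> along the edges. On indicator vectors
  it is the slack in a semistability inequality, and it is the extension of this set function that is linear on
  vectors with the same ordering of coordinates (its Lovasz extension).
\<close>

definition cut_form :: "(('v, 'e) point \<Rightarrow> int) \<Rightarrow> real ^ 'v \<Rightarrow> real ^ 'v \<Rightarrow> real" where
  "cut_form D q h = q \<bullet> h - (\<Sum>v\<in>UNIV. of_int (D (Vertex v)) * h $ v)
     - (\<Sum>e\<in>arcs G. of_int (edge_degree D e) * ((h $ tail G e + h $ head G e) / 2))
     + (\<Sum>e\<in>arcs G. (1 - of_int (edge_degree D e)) / 2 * \<bar>difference h e\<bar>)"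

lemma inner_indicator_vec: "q \<bullet> indicator_vec I = (\<Sum>v\<in>I. q $ v)" for q :: "real ^ 'v"
  unfolding inner_vec_def by (rule sum.mono_neutral_cong_right) auto

lemma cut_form_indicator:
  assumes D: "D \<in> divisors G len"
  shows "cut_form D q (indicator_vec I) = (\<Sum>v\<in>I. q $ v) - of_int (deg_on D (sub_metric_graph G len I))
    - (\<Sum>e\<in>arcs G. of_int (edge_degree D e) * \<bar>difference (indicator_vec I) e\<bar>)
    + real (num_edges_between G I (- I)) / 2"
proof -
  let ?n = "\<lambda>e. real_of_int (edge_degree D e)" and ?h = "indicator_vec I"
  have "(\<Sum>e\<in>arcs G. (1 - ?n e) / 2 * \<bar>difference ?h e\<bar>) - (\<Sum>e\<in>arcs G. ?n e * ((?h $ tail G e + ?h $ head G e) / 2))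
    = (\<Sum>e\<in>arcs G. \<bar>difference ?h e\<bar> / 2 - ?n e * \<bar>difference ?h e\<bar>
          - ?n e * (indicator I (tail G e) * indicator I (head G e)))"
    unfolding sum_subtractf[symmetric]
    by (intro sum.cong) (auto simp: indicator_def field_simps)
  then show ?thesis
    unfolding cut_form_def inner_indicator_vec num_edges_between_eq deg_on_sub_metric_graph[OF D]
    by (simp add: sum_subtractf sum_divide_distrib)
qed

text \<open>
  Points inside edges that join \<open>I\<close> to its complement are counted on neither side.
\<close>

lemma deg_on_complement:
  assumes D: "D \<in> divisors G len"
  shows "real_of_int (deg_on D (sub_metric_graph G len I)) + of_int (deg_on D (sub_metric_graph G len (- I)))
    + (\<Sum>e\<in>arcs G. of_int (edge_degree D e) * \<bar>difference (indicator_vec I) e\<bar>) = of_int (degree D)"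
proof -
  have v: "(\<Sum>v\<in>UNIV. real_of_int (D (Vertex v)))
    = (\<Sum>v\<in>UNIV. of_int (D (Vertex v)) * indicator I v) + (\<Sum>v\<in>UNIV. of_int (D (Vertex v)) * indicator (- I) v)"
    unfolding sum.distrib[symmetric] by (intro sum.cong) (auto simp: indicator_def)
  have e: "(\<Sum>e\<in>arcs G. real_of_int (edge_degree D e))
    = (\<Sum>e\<in>arcs G. of_int (edge_degree D e) * (indicator I (tail G e) * indicator I (head G e)))
    + (\<Sum>e\<in>arcs G. of_int (edge_degree D e) * (indicator (- I) (tail G e) * indicator (- I) (head G e)))
    + (\<Sum>e\<in>arcs G. of_int (edge_degree D e) * \<bar>difference (indicator_vec I) e\<bar>)"
    unfolding sum.distrib[symmetric] by (intro sum.cong) (auto simp: indicator_def)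
  show ?thesis unfolding degree_eq[OF D] v e deg_on_sub_metric_graph[OF D] by simp
qed

lemma cut_form_const:
  assumes D: "D \<in> divisors G len" and q: "q \<in> hyperplane_deg (degree D)"
  shows "cut_form D q (\<chi> v. c) = 0"
proof -
  have "cut_form D q (\<chi> v. c) = c * ((\<Sum>v\<in>UNIV. q $ v)
      - ((\<Sum>v\<in>UNIV. real_of_int (D (Vertex v))) + (\<Sum>e\<in>arcs G. of_int (edge_degree D e))))"
    by (simp add: cut_form_def inner_vec_def sum_distrib_left algebra_simps)
  then show ?thesis using q degree_eq[OF D] by (simp add: hyperplane_deg_def)
qed

text \<open>
  Induction on the number of values of \<open>h\<close>. Let \<open>I\<close> be the set where \<open>h\<close> attains its maximum, and lower \<open>h\<close> on
  \<open>I\<close> to the second largest value. This removes a multiple of the indicator vector of \<open>I\<close>, and no edge difference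
  changes sign, so that the absolute values, and with them the cut form, split additively.
\<close>

lemma cut_form_nonneg_of_indicators:
  assumes D: "D \<in> divisors G len" and q: "q \<in> hyperplane_deg (degree D)"
    and cut: "\<And>I. 0 \<le> cut_form D q (indicator_vec I)"
  shows "0 \<le> cut_form D q h"
proof (induction "card (range (($) h))" arbitrary: h rule: less_induct)
  case less
  define M where "M = Max (range (($) h))"
  define I where "I = {v. h $ v = M}"
  have M: "h $ v \<le> M" for v unfolding M_def by simp
  have "M \<in> range (($) h)" unfolding M_def by (rule Max_in) auto
  then obtain w where w: "h $ w = M" by auto
  show ?case
  proof (cases "I = UNIV")
    case True
    then have "h = (\<chi> v. M)" by (auto simp: I_def vec_eq_iff)
    then show ?thesis using cut_form_const[OF D q] by simp
  next
    case False
    define M' where "M' = Max (range (($) h) - {M})"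
    have ne: "range (($) h) - {M} \<noteq> {}" using False by (auto simp: I_def)
    have "M' \<in> range (($) h) - {M}" unfolding M'_def by (rule Max_in) (use ne in auto)
    then have lt: "M' < M" using M by (force simp: less_le)
    have M': "h $ v \<le> M'" if "v \<notin> I" for v
      unfolding M'_def using that by (intro Max_ge) (auto simp: I_def)
    define h' where "h' = h - (M - M') *\<^sub>R indicator_vec I"
    have h': "h' $ v = (if v \<in> I then M' else h $ v)" for v
      by (simp add: h'_def I_def)
    have "range (($) h') \<subseteq> range (($) h) - {M}"
      using \<open>M' \<in> range (($) h) - {M}\<close> lt by (auto simp: h' I_def)
    then have "range (($) h') \<subset> range (($) h)" using \<open>M \<in> range (($) h)\<close> by blast
    then have "card (range (($) h')) < card (range (($) h))" by (intro psubset_card_mono) auto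
    then have 1: "0 \<le> cut_form D q h'" by (rule less)
    have abs: "\<bar>difference h e\<bar> = \<bar>difference h' e\<bar> + (M - M') * \<bar>difference (indicator_vec I) e\<bar>" for e
      using M'[of "head G e"] M'[of "tail G e"] lt by (auto simp: h' I_def indicator_def)
    have h: "h = h' + (M - M') *\<^sub>R indicator_vec I" by (simp add: h'_def)
    have hv: "h $ v = h' $ v + (M - M') * indicator_vec I $ v" for v
      by (simp add: h'_def)
    have "cut_form D q h = cut_form D q h' + (M - M') * cut_form D q (indicator_vec I)"
    proof -
      have a: "q \<bullet> h = q \<bullet> h' + (M - M') * (q \<bullet> indicator_vec I)"
        by (subst h) (simp only: inner_add_right inner_scaleR_right)
      have b: "(\<Sum>v\<in>UNIV. of_int (D (Vertex v)) * h $ v) = (\<Sum>v\<in>UNIV. of_int (D (Vertex v)) * h' $ v)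
        + (M - M') * (\<Sum>v\<in>UNIV. of_int (D (Vertex v)) * indicator_vec I $ v)"
        unfolding sum_distrib_left sum.distrib[symmetric]
        by (intro sum.cong refl) (simp add: hv algebra_simps)
      have c: "(\<Sum>e\<in>arcs G. of_int (edge_degree D e) * ((h $ tail G e + h $ head G e) / 2))
        = (\<Sum>e\<in>arcs G. of_int (edge_degree D e) * ((h' $ tail G e + h' $ head G e) / 2))
        + (M - M') * (\<Sum>e\<in>arcs G. of_int (edge_degree D e) * ((indicator_vec I $ tail G e + indicator_vec I $ head G e) / 2))"
        unfolding sum_distrib_left sum.distrib[symmetric]
        by (intro sum.cong refl) (simp add: hv field_simps)
      have d: "(\<Sum>e\<in>arcs G. (1 - of_int (edge_degree D e)) / 2 * \<bar>difference h e\<bar>)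
        = (\<Sum>e\<in>arcs G. (1 - of_int (edge_degree D e)) / 2 * \<bar>difference h' e\<bar>)
        + (M - M') * (\<Sum>e\<in>arcs G. (1 - of_int (edge_degree D e)) / 2 * \<bar>difference (indicator_vec I) e\<bar>)"
        unfolding abs sum_distrib_left sum.distrib[symmetric]
        by (intro sum.cong refl) (simp only: distrib_left mult.left_commute)
      show ?thesis unfolding cut_form_def a b c d by (simp add: algebra_simps)
    qed
    then show ?thesis using 1 cut[of I] lt by simp
  qed
qed

text \<open>
  Nonnegativity of the cut form on the indicator of \<open>I\<close> is the upper bound on \<open>q(- I)\<close>. Letting \<open>I\<close> vary gives
  all upper bounds. The lower bound for \<open>I\<close> is weaker than the upper bound for its complement,
  the difference being the degree inside the edges joining the two sides.
\<close>

lemma semistability_polytope_iff: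
  assumes D: "D \<in> divisors G len" and nonneg: "\<And>e. e \<in> arcs G \<Longrightarrow> 0 \<le> edge_degree D e"
  shows "q \<in> semistability_polytope G len D \<longleftrightarrow>
    q \<in> hyperplane_deg (degree D) \<and> (\<forall>h. 0 \<le> cut_form D q h)"
proof (cases "q \<in> hyperplane_deg (degree D)")
  case True
  let ?q = "\<lambda>I. \<Sum>v\<in>I. q $ v"
  let ?N = "\<lambda>I. real (num_edges_between G I (- I)) / 2"
  let ?d = "\<lambda>I. real_of_int (deg_on D (sub_metric_graph G len I))"
  let ?c = "\<lambda>I. \<Sum>e\<in>arcs G. real_of_int (edge_degree D e) * \<bar>difference (indicator_vec I) e\<bar>"
  have qd: "?q UNIV = of_int (degree D)" using True by (simp add: hyperplane_deg_def)
  have qc: "?q I + ?q (- I) = of_int (degree D)" for I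
    unfolding qd[symmetric] by (subst sum.union_disjoint[symmetric]) (auto simp: Compl_partition)
  have N: "?N (- I) = ?N I" for I
    by (simp add: num_edges_between_def disj_commute)
  have c0: "0 \<le> ?c I" for I by (intro sum_nonneg mult_nonneg_nonneg) (use nonneg in auto)
  have cut: "cut_form D q (indicator_vec I) = ?q I - ?d I - ?c I + ?N I" for I
    by (rule cut_form_indicator[OF D])
  have compl: "?d I + ?d (- I) + ?c I = of_int (degree D)" for I by (rule deg_on_complement[OF D])
  \<comment> \<open>The total degrees of \<open>q\<close> and \<open>D\<close> agree, which turns the slack for \<open>I\<close> into one for its complement.\<close>
  have cut': "cut_form D q (indicator_vec I) = ?d (- I) - ?q (- I) + ?N (- I)" for I
    using cut[of I] compl[of I] qc[of I] N[of I] by simp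
  have "(\<forall>I. I \<noteq> {} \<and> I \<noteq> UNIV \<longrightarrow> \<bar>?d I - ?q I\<bar> \<le> ?N I) \<longleftrightarrow> (\<forall>h. 0 \<le> cut_form D q h)"
  proof (intro iffI allI impI)
    fix h assume *: "\<forall>I. I \<noteq> {} \<and> I \<noteq> UNIV \<longrightarrow> \<bar>?d I - ?q I\<bar> \<le> ?N I"
    have "0 \<le> cut_form D q (indicator_vec I)" for I
    proof (cases "I = {} \<or> I = UNIV")
      case True
      moreover have "indicator_vec {} = (\<chi> v. 0)" "indicator_vec UNIV = (\<chi> v. 1)" by simp_all
      ultimately obtain c where "indicator_vec I = (\<chi> v. c)" by metis
      then show ?thesis using cut_form_const[OF D \<open>q \<in> _\<close>] by simp
    next
      case False
      then have "- I \<noteq> {} \<and> - I \<noteq> UNIV"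
        by (metis Compl_UNIV_eq Compl_empty_eq double_complement)
      then have "\<bar>?d (- I) - ?q (- I)\<bar> \<le> ?N (- I)" by (rule *[rule_format])
      then show ?thesis using cut'[of I] by linarith
    qed
    then show "0 \<le> cut_form D q h" by (rule cut_form_nonneg_of_indicators[OF D True])
  next
    fix I assume *: "\<forall>h. 0 \<le> cut_form D q h"
    have "0 \<le> cut_form D q (indicator_vec I)" "0 \<le> cut_form D q (indicator_vec (- I))" using * by blast+
    then have "0 \<le> ?q I - ?d I - ?c I + ?N I" "0 \<le> ?d I - ?q I + ?N I"
      using cut[of I] cut'[of "- I"] by simp_all
    then show "\<bar>?d I - ?q I\<bar> \<le> ?N I" using c0[of I] by linarith
  qed
  then show ?thesis using True unfolding semistability_polytope_def by simp
qed (simp add: semistability_polytope_def)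

section \<open>Semistability as minimality of an energy\<close>

text \<open>
  This is where the connectedness of the graph enters.
\<close>

lemma constant_of_difference_zero:
  assumes "\<And>e. e \<in> arcs G \<Longrightarrow> h (head G e) = h (tail G e)"
  shows "h v = h w"
proof -
  have "v \<rightarrow>\<^sup>*\<^bsub>with_proj (mk_symmetric G)\<^esub> w"
    using model unfolding metric_graph_model_def connected_def strongly_connected_def by simp
  then show ?thesis
    unfolding reachable_def
  proof (induction rule: rtrancl_on_induct)
    case (step x y)
    then have "(x, y) \<in> parcs (mk_symmetric G)" by (auto simp: arcs_ends_def arc_to_ends_def)
    then have "h x = h y" using assms by (auto simp: mk_symmetric_def)
    then show ?case using step.IH by simp
  qed simp
qed

text \<open>
  The linear term makes the subgradients of the energy match, up to sign, the vertex values of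
  \<open>admissible_rep D \<phi>\<close>, into which \<open>D\<close> enters through its values at the vertices and, at the heads of the edges, its degrees inside them.
\<close>

definition energy :: "(('v, 'e) point \<Rightarrow> int) \<Rightarrow> real ^ 'v \<Rightarrow> real" where
  "energy D \<phi> = (\<Sum>e\<in>arcs G. len e * staircase_primitive (mean_slope D \<phi> e))
     - (\<Sum>v\<in>UNIV. (of_int (D (Vertex v)) + (\<Sum>e\<in>in_arcs G v. of_int (edge_degree D e))) * \<phi> $ v)"

lemma mean_slope_add:
  "mean_slope D (\<phi> + h) e = mean_slope D \<phi> e + difference h e / len e"
  by (simp add: mean_slope_def add_divide_distrib[symmetric] algebra_simps)

lemma sum_admissible_rep_Vertex:
  fixes h :: "real ^ 'v"
  shows "(\<Sum>v\<in>UNIV. of_int (admissible_rep D \<phi> (Vertex v)) * h $ v)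
    = (\<Sum>v\<in>UNIV. (of_int (D (Vertex v)) + (\<Sum>e\<in>in_arcs G v. of_int (edge_degree D e))) * h $ v)
      + (\<Sum>e\<in>arcs G. of_int \<lfloor>mean_slope D \<phi> e\<rfloor> * h $ tail G e)
      - (\<Sum>e\<in>arcs G. of_int \<lceil>mean_slope D \<phi> e\<rceil> * h $ head G e)"
  unfolding sum_out_arcs[symmetric] sum_in_arcs[symmetric] sum.distrib[symmetric] sum_subtractf[symmetric]
  by (intro sum.cong refl) (simp add: admissible_rep_Vertex sum_subtractf algebra_simps)

lemma degree_admissible_rep:
  assumes "D \<in> divisors G len"
  shows "degree (admissible_rep D \<phi>) = degree D"
proof -
  have "(\<Sum>v\<in>UNIV. \<Sum>e\<in>in_arcs G v. real_of_int (edge_degree D e)) = (\<Sum>e\<in>arcs G. of_int (edge_degree D e))"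
    using sum_in_arcs[of "\<lambda>e. of_int (edge_degree D e)" "\<chi> v. 1"] by simp
  then have "(\<Sum>v\<in>UNIV. real_of_int (admissible_rep D \<phi> (Vertex v)))
      + (\<Sum>e\<in>arcs G. of_int (edge_degree (admissible_rep D \<phi>) e))
    = (\<Sum>v\<in>UNIV. real_of_int (D (Vertex v))) + (\<Sum>e\<in>arcs G. of_int (edge_degree D e))"
    using sum_admissible_rep_Vertex[of D \<phi> "\<chi> v. 1"]
    by (simp add: edge_degree_admissible_rep sum_subtractf sum.distrib)
  then have "real_of_int (degree (admissible_rep D \<phi>)) = of_int (degree D)"
    unfolding degree_eq[OF admissible_rep_divisor] degree_eq[OF assms] .
  then show ?thesis by simp
qed

text \<open>
  With floors at the tails, ceilings at the heads, and half of \<open>\<lceil>y\<rceil> - \<lfloor>y\<rfloor>\<close> assigned to each end, every edge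
  contributes the same coefficient \<open>(\<lfloor>y\<rfloor> + \<lceil>y\<rceil>) / 2\<close> at both ends, up to sign. The right-hand side is therefore the
  directional derivative of the energy.
\<close>

lemma cut_form_admissible_rep:
  "cut_form (admissible_rep D \<phi>) q h = q \<bullet> h
     - (\<Sum>v\<in>UNIV. (of_int (D (Vertex v)) + (\<Sum>e\<in>in_arcs G v. of_int (edge_degree D e))) * h $ v)
     + (\<Sum>e\<in>arcs G. (of_int \<lfloor>mean_slope D \<phi> e\<rfloor> + of_int \<lceil>mean_slope D \<phi> e\<rceil>) / 2 * difference h e
          + (1 - (of_int \<lceil>mean_slope D \<phi> e\<rceil> - of_int \<lfloor>mean_slope D \<phi> e\<rfloor>)) / 2 * \<bar>difference h e\<bar>)"
proof -
  let ?f = "\<lambda>e. real_of_int \<lfloor>mean_slope D \<phi> e\<rfloor>" and ?c = "\<lambda>e. real_of_int \<lceil>mean_slope D \<phi> e\<rceil>"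
  have n: "real_of_int (edge_degree (admissible_rep D \<phi>) e) = ?c e - ?f e" if "e \<in> arcs G" for e
    using edge_degree_admissible_rep[OF that] by simp
  have "(\<Sum>e\<in>arcs G. ?c e * h $ head G e) - (\<Sum>e\<in>arcs G. ?f e * h $ tail G e)
      - (\<Sum>e\<in>arcs G. of_int (edge_degree (admissible_rep D \<phi>) e) * ((h $ tail G e + h $ head G e) / 2))
      + (\<Sum>e\<in>arcs G. (1 - of_int (edge_degree (admissible_rep D \<phi>) e)) / 2 * \<bar>difference h e\<bar>)
    = (\<Sum>e\<in>arcs G. (?f e + ?c e) / 2 * difference h e + (1 - (?c e - ?f e)) / 2 * \<bar>difference h e\<bar>)"
    unfolding sum_subtractf[symmetric] sum.distrib[symmetric]
    by (intro sum.cong refl) (simp add: n field_simps)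
  then show ?thesis
    unfolding cut_form_def sum_admissible_rep_Vertex by linarith
qed

lemma energy_subgradient:
  "energy D \<phi> + q \<bullet> \<phi> + cut_form (admissible_rep D \<phi>) q h \<le> energy D (\<phi> + h) + q \<bullet> (\<phi> + h)"
proof -
  let ?y = "mean_slope D \<phi>"
  let ?s = "\<lambda>e. (of_int \<lfloor>?y e\<rfloor> + of_int \<lceil>?y e\<rceil>) / 2 * difference h e
          + (1 - (of_int \<lceil>?y e\<rceil> - of_int \<lfloor>?y e\<rfloor>)) / 2 * \<bar>difference h e\<bar>"
  have "len e * staircase_primitive (?y e) + ?s e \<le> len e * staircase_primitive (mean_slope D (\<phi> + h) e)"
    if "e \<in> arcs G" for e
  proof -
    note L = len_pos[OF that]
    have "len e * (staircase_primitive (?y e) + (of_int \<lfloor>?y e\<rfloor> + of_int \<lceil>?y e\<rceil>) / 2 * (difference h e / len e)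
        + (1 - (of_int \<lceil>?y e\<rceil> - of_int \<lfloor>?y e\<rfloor>)) / 2 * \<bar>difference h e / len e\<bar>)
      \<le> len e * staircase_primitive (mean_slope D (\<phi> + h) e)"
      using staircase_primitive_subgradient[of "?y e" "mean_slope D (\<phi> + h) e"] L
      by (intro mult_left_mono) (simp_all add: mean_slope_add)
    then show ?thesis using L by (simp add: distrib_left abs_divide mult.left_commute[of "len e"])
  qed
  then have "(\<Sum>e\<in>arcs G. len e * staircase_primitive (?y e)) + (\<Sum>e\<in>arcs G. ?s e)
      \<le> (\<Sum>e\<in>arcs G. len e * staircase_primitive (mean_slope D (\<phi> + h) e))"
    unfolding sum.distrib[symmetric] by (rule sum_mono)
  then show ?thesis
    by (simp add: energy_def cut_form_admissible_rep inner_add_right distrib_left sum.distrib)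
qed

lemma energy_locally_conic:
  "eventually (\<lambda>t. energy D (\<phi> + t *\<^sub>R h) + q \<bullet> (\<phi> + t *\<^sub>R h)
      = energy D \<phi> + q \<bullet> \<phi> + t * cut_form (admissible_rep D \<phi>) q h) (at_right 0)"
proof -
  let ?y = "mean_slope D \<phi>"
  let ?s = "\<lambda>e. (of_int \<lfloor>?y e\<rfloor> + of_int \<lceil>?y e\<rceil>) / 2 * difference h e
          + (1 - (of_int \<lceil>?y e\<rceil> - of_int \<lfloor>?y e\<rfloor>)) / 2 * \<bar>difference h e\<bar>"
  have edge: "eventually (\<lambda>t. len e * staircase_primitive (mean_slope D (\<phi> + t *\<^sub>R h) e)
      = len e * staircase_primitive (?y e) + t * ?s e) (at_right 0)" if "e \<in> arcs G" for e
  proof -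
    note L = len_pos[OF that]
    have m: "mean_slope D (\<phi> + t *\<^sub>R h) e = ?y e + t * (difference h e / len e)" for t
      by (simp add: mean_slope_add algebra_simps diff_divide_distrib)
    have "((\<lambda>t. ?y e + t * (difference h e / len e)) \<longlongrightarrow> ?y e + 0 * (difference h e / len e)) (at_right 0)"
      by (intro tendsto_intros)
    then have lim: "filterlim (\<lambda>t. mean_slope D (\<phi> + t *\<^sub>R h) e) (nhds (?y e)) (at_right 0)"
      by (simp add: m)
    have "eventually (\<lambda>t::real. 0 < t) (at_right 0)" by (rule eventually_at_right_less)
    with eventually_compose_filterlim[OF staircase_primitive_locally_conic lim]
    show ?thesis
    proof eventually_elim
      case (elim t)
      define A where "A = (real_of_int \<lfloor>?y e\<rfloor> + of_int \<lceil>?y e\<rceil>) / 2"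
      define B where "B = (1 - (real_of_int \<lceil>?y e\<rceil> - of_int \<lfloor>?y e\<rfloor>)) / 2"
      define r where "r = t * (difference h e / len e)"
      have r: "len e * r = t * difference h e" "len e * \<bar>r\<bar> = t * \<bar>difference h e\<bar>"
        using L elim(2) by (simp_all add: r_def abs_mult abs_divide)
      have "staircase_primitive (mean_slope D (\<phi> + t *\<^sub>R h) e)
          = staircase_primitive (?y e) + A * r + B * \<bar>r\<bar>"
        using elim(1) unfolding A_def B_def r_def m by (simp only: add_diff_cancel_left')
      then have "len e * staircase_primitive (mean_slope D (\<phi> + t *\<^sub>R h) e)
          = len e * staircase_primitive (?y e) + A * (len e * r) + B * (len e * \<bar>r\<bar>)"
        by (simp add: distrib_left)
      also have "\<dots> = len e * staircase_primitive (?y e) + t * (A * difference h e + B * \<bar>difference h e\<bar>)"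
        unfolding r by (simp add: distrib_left)
      finally show ?case unfolding A_def B_def .
    qed
  qed
  have "eventually (\<lambda>t. \<forall>e\<in>arcs G. len e * staircase_primitive (mean_slope D (\<phi> + t *\<^sub>R h) e)
      = len e * staircase_primitive (?y e) + t * ?s e) (at_right 0)"
    using edge by (intro eventually_ball_finite) auto
  then show ?thesis
  proof eventually_elim
    case (elim t)
    then have 1: "(\<Sum>e\<in>arcs G. len e * staircase_primitive (mean_slope D (\<phi> + t *\<^sub>R h) e))
      = (\<Sum>e\<in>arcs G. len e * staircase_primitive (?y e)) + t * (\<Sum>e\<in>arcs G. ?s e)"
      unfolding sum_distrib_left sum.distrib[symmetric] by (intro sum.cong refl) blast
    have 2: "(\<Sum>v\<in>UNIV. w v * (\<phi> + t *\<^sub>R h) $ v) = (\<Sum>v\<in>UNIV. w v * \<phi> $ v) + t * (\<Sum>v\<in>UNIV. w v * h $ v)" for w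
      unfolding sum_distrib_left sum.distrib[symmetric]
      by (intro sum.cong refl) (simp add: algebra_simps)
    show ?case
      unfolding energy_def cut_form_admissible_rep 1 2 inner_add_right inner_scaleR_right
      by (simp add: distrib_left right_diff_distrib)
  qed
qed

text \<open>
  By local conicity the cut form is the directional derivative, which is nonnegative at a minimum; by the
  subgradient inequality its nonnegativity is also sufficient.
\<close>

lemma energy_minimal_iff:
  "(\<forall>\<psi>. energy D \<phi> + q \<bullet> \<phi> \<le> energy D \<psi> + q \<bullet> \<psi>)
     \<longleftrightarrow> (\<forall>h. 0 \<le> cut_form (admissible_rep D \<phi>) q h)"
proof (intro iffI allI)
  fix h assume min: "\<forall>\<psi>. energy D \<phi> + q \<bullet> \<phi> \<le> energy D \<psi> + q \<bullet> \<psi>"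
  have "eventually (\<lambda>t::real. 0 < t) (at_right 0)" by (rule eventually_at_right_less)
  with energy_locally_conic[of D \<phi> h q]
  have "eventually (\<lambda>t::real. 0 \<le> cut_form (admissible_rep D \<phi>) q h) (at_right 0)"
  proof eventually_elim
    case (elim t)
    then have "0 \<le> t * cut_form (admissible_rep D \<phi>) q h"
      using min[rule_format, of "\<phi> + t *\<^sub>R h"] by linarith
    then show ?case using elim(2) by (simp add: zero_le_mult_iff)
  qed
  then show "0 \<le> cut_form (admissible_rep D \<phi>) q h" by simp
next
  fix \<psi> assume "\<forall>h. 0 \<le> cut_form (admissible_rep D \<phi>) q h"
  then have "0 \<le> cut_form (admissible_rep D \<phi>) q (\<psi> - \<phi>)" by blast
  then show "energy D \<phi> + q \<bullet> \<phi> \<le> energy D \<psi> + q \<bullet> \<psi>"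
    using energy_subgradient[of D \<phi> q "\<psi> - \<phi>"] by simp
qed

lemma edge_degree_admissible_rep_nonneg:
  "e \<in> arcs G \<Longrightarrow> 0 \<le> edge_degree (admissible_rep D \<phi>) e"
  by (simp add: edge_degree_admissible_rep)

lemma mem_semistability_polytope_iff_minimal:
  assumes "D \<in> divisors G len"
  shows "q \<in> semistability_polytope G len (admissible_rep D \<phi>) \<longleftrightarrow>
    q \<in> hyperplane_deg (degree D) \<and> (\<forall>\<psi>. energy D \<phi> + q \<bullet> \<phi> \<le> energy D \<psi> + q \<bullet> \<psi>)"
  using semistability_polytope_iff[OF admissible_rep_divisor edge_degree_admissible_rep_nonneg]
  by (simp add: degree_admissible_rep[OF assms] energy_minimal_iff)

text \<open>
  The polytope depends on the potential only through the cell of the arrangement in which it lies.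
\<close>

lemma semistability_polytope_cong:
  assumes D: "D \<in> divisors G len"
    and cell: "\<And>e. e \<in> arcs G \<Longrightarrow> \<lfloor>mean_slope D \<phi> e\<rfloor> = \<lfloor>mean_slope D \<psi> e\<rfloor>"
      "\<And>e. e \<in> arcs G \<Longrightarrow> \<lceil>mean_slope D \<phi> e\<rceil> = \<lceil>mean_slope D \<psi> e\<rceil>"
  shows "semistability_polytope G len (admissible_rep D \<phi>) = semistability_polytope G len (admissible_rep D \<psi>)"
proof -
  have "cut_form (admissible_rep D \<phi>) q h = cut_form (admissible_rep D \<psi>) q h" for q h
    unfolding cut_form_admissible_rep using cell by simp
  then show ?thesis
    using semistability_polytope_iff[OF admissible_rep_divisor edge_degree_admissible_rep_nonneg]
    by (auto simp: degree_admissible_rep[OF D])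
qed

section \<open>The polytopes cover the hyperplane and meet in faces\<close>

text \<open>
  The inequalities for one-element sets \<open>I\<close> already make the polyhedron bounded, except that on a single vertex
  there are none and the hyperplane itself is a point.
\<close>

lemma polytope_semistability_polytope: "polytope (semistability_polytope G len D)"
proof -
  let ?b = "\<lambda>I. real (num_edges_between G I (- I)) / 2"
  let ?c = "\<lambda>I. real_of_int (deg_on D (sub_metric_graph G len I))"
  define slab where "slab = (\<lambda>I. {q :: real ^ 'v. indicator_vec I \<bullet> q \<le> ?c I + ?b I} \<inter> {q. indicator_vec I \<bullet> q \<ge> ?c I - ?b I})"
  have inner: "indicator_vec I \<bullet> q = (\<Sum>v\<in>I. q $ v)" for I and q :: "real ^ 'v"
    by (subst inner_commute) (rule inner_indicator_vec)
  have slab: "q \<in> slab I \<longleftrightarrow> \<bar>?c I - (\<Sum>v\<in>I. q $ v)\<bar> \<le> ?b I" for q I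
  proof -
    have "(s \<le> c + b \<and> c - b \<le> s) \<longleftrightarrow> \<bar>c - s\<bar> \<le> b" for s c b :: real by auto
    then show ?thesis unfolding slab_def by (simp only: inner Int_iff mem_Collect_eq)
  qed
  have eq: "semistability_polytope G len D
    = {q. indicator_vec UNIV \<bullet> q = of_int (degree D)} \<inter> (\<Inter>I\<in>{I. I \<noteq> {} \<and> I \<noteq> UNIV}. slab I)"
    by (rule set_eqI) (simp only: semistability_polytope_def hyperplane_deg_def slab inner
        Int_iff mem_Collect_eq INT_iff Ball_def)
  have "polyhedron (\<Inter>(slab ` {I. I \<noteq> {} \<and> I \<noteq> UNIV}))"
    by (intro polyhedron_Inter) (auto simp: slab_def intro!: polyhedron_Int polyhedron_halfspace_le polyhedron_halfspace_ge)
  then have "polyhedron (semistability_polytope G len D)"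
    unfolding eq by (intro polyhedron_Int polyhedron_hyperplane)
  moreover have "bounded (semistability_polytope G len D)"
  proof (rule boundedI)
    fix q assume q: "q \<in> semistability_polytope G len D"
    let ?K = "\<lambda>v. \<bar>of_int (degree D)\<bar> + \<bar>?c {v}\<bar> + ?b {v}"
    have "\<bar>q $ v\<bar> \<le> ?K v" for v
    proof (cases "{v} = UNIV")
      case True
      have "(\<Sum>u\<in>UNIV. q $ u) = q $ v" by (subst True[symmetric]) simp
      then show ?thesis using q by (simp add: semistability_polytope_def hyperplane_deg_def)
    next
      case False
      then have "{v} \<noteq> {} \<and> {v} \<noteq> UNIV" by simp
      then have "\<bar>?c {v} - (\<Sum>u\<in>{v}. q $ u)\<bar> \<le> ?b {v}"
        using q unfolding semistability_polytope_def by blast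
      then have "\<bar>?c {v} - q $ v\<bar> \<le> ?b {v}" by simp
      then show ?thesis by linarith
    qed
    then have "(\<Sum>v\<in>UNIV. \<bar>q $ v\<bar>) \<le> (\<Sum>v\<in>UNIV. ?K v)" by (intro sum_mono)
    then show "norm q \<le> (\<Sum>v\<in>UNIV. ?K v)" using norm_le_l1_cart[of q] by linarith
  qed
  ultimately show ?thesis by (simp add: polytope_eq_bounded_polyhedron)
qed

text \<open>
  On the polytope of \<open>\<phi>\<close> the value at \<open>\<psi>\<close> exceeds the minimal value by \<open>(\<psi> - \<phi>) \<bullet> q\<close> plus a constant. So
  the points \<open>q\<close> for which \<open>\<psi>\<close> is a minimizer too are cut out by a supporting hyperplane.
\<close>

lemma semistability_polytopes_meet_in_face:
  assumes D: "D \<in> divisors G len"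
  shows "semistability_polytope G len (admissible_rep D \<phi>) \<inter> semistability_polytope G len (admissible_rep D \<psi>)
    face_of semistability_polytope G len (admissible_rep D \<phi>)"
proof -
  let ?P = "\<lambda>\<phi>. semistability_polytope G len (admissible_rep D \<phi>)"
  let ?b = "energy D \<phi> - energy D \<psi>"
  note iff = mem_semistability_polytope_iff_minimal[OF D]
  have ge: "?b \<le> (\<psi> - \<phi>) \<bullet> q" if "q \<in> ?P \<phi>" for q
    using that iff[of q \<phi>] by (auto simp: inner_diff_left inner_commute[of q] algebra_simps)
  have "?P \<phi> \<inter> ?P \<psi> = ?P \<phi> \<inter> {q. (\<psi> - \<phi>) \<bullet> q = ?b}"
  proof (intro equalityI subsetI)
    fix q assume q: "q \<in> ?P \<phi> \<inter> ?P \<psi>"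
    then have "energy D \<phi> + q \<bullet> \<phi> = energy D \<psi> + q \<bullet> \<psi>"
      using iff[of q \<phi>] iff[of q \<psi>] by (intro antisym) auto
    then show "q \<in> ?P \<phi> \<inter> {q. (\<psi> - \<phi>) \<bullet> q = ?b}"
      using q by (simp add: inner_diff_left inner_commute[of q])
  next
    fix q assume q: "q \<in> ?P \<phi> \<inter> {q. (\<psi> - \<phi>) \<bullet> q = ?b}"
    then have "energy D \<phi> + q \<bullet> \<phi> = energy D \<psi> + q \<bullet> \<psi>"
      by (simp add: inner_diff_left inner_commute[of q])
    then show "q \<in> ?P \<phi> \<inter> ?P \<psi>"
      using q iff[of q \<phi>] iff[of q \<psi>] by auto
  qed
  moreover have "?P \<phi> \<inter> {q. (\<psi> - \<phi>) \<bullet> q = ?b} face_of ?P \<phi>"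
    by (rule face_of_Int_supporting_hyperplane_ge)
      (use polytope_imp_convex[OF polytope_semistability_polytope] ge in auto)
  ultimately show ?thesis by simp
qed

text \<open>
  Cut forms vanish on constant vectors, so the subgradient inequality in a constant direction and in its opposite gives both
  estimates.
\<close>

lemma energy_shift_const:
  assumes D: "D \<in> divisors G len" and q: "q \<in> hyperplane_deg (degree D)"
  shows "energy D (\<phi> + (\<chi> v. c)) + q \<bullet> (\<phi> + (\<chi> v. c)) = energy D \<phi> + q \<bullet> \<phi>"
proof -
  have "cut_form (admissible_rep D \<psi>) q (\<chi> v. c) = 0" for \<psi> c
    by (rule cut_form_const[OF admissible_rep_divisor]) (use q in \<open>simp add: degree_admissible_rep[OF D]\<close>)
  then have "energy D \<psi> + q \<bullet> \<psi> \<le> energy D (\<psi> + (\<chi> v. c)) + q \<bullet> (\<psi> + (\<chi> v. c))" for \<psi> c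
    using energy_subgradient[of D \<psi> q "\<chi> v. c"] by simp
  from this[of \<phi> c] this[of "\<phi> + (\<chi> v. c)" "- c"]
  have "energy D \<phi> + q \<bullet> \<phi> \<le> energy D (\<phi> + (\<chi> v. c)) + q \<bullet> (\<phi> + (\<chi> v. c))"
    "energy D (\<phi> + (\<chi> v. c)) + q \<bullet> (\<phi> + (\<chi> v. c))
      \<le> energy D (\<phi> + (\<chi> v. c) + (\<chi> v. - c)) + q \<bullet> (\<phi> + (\<chi> v. c) + (\<chi> v. - c))" by blast+
  moreover have "\<phi> + (\<chi> v. c) + (\<chi> v. - c) = \<phi>" by (simp add: vec_eq_iff)
  ultimately show ?thesis by simp
qed

text \<open>
  On a connected graph the Dirichlet form vanishes only on constants, hence it becomes positive definite once
  the value at one vertex \<open>w\<close> is added. The constant \<open>m\<close> is its minimum on the unit sphere.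
\<close>

lemma dirichlet_form_pos_def:
  obtains m where "0 < m"
    "\<And>\<phi> :: real ^ 'v. m * (norm \<phi>)\<^sup>2 \<le> (\<phi> $ w)\<^sup>2 + (\<Sum>e\<in>arcs G. (difference \<phi> e)\<^sup>2 / (4 * len e))"
proof -
  let ?R = "\<lambda>\<phi> :: real ^ 'v. (\<phi> $ w)\<^sup>2 + (\<Sum>e\<in>arcs G. (difference \<phi> e)\<^sup>2 / (4 * len e))"
  have term0: "0 \<le> (difference \<phi> e)\<^sup>2 / (4 * len e)" if "e \<in> arcs G" for \<phi> e
    using len_pos[OF that] by simp
  have "continuous_on (sphere 0 1) ?R"
    by (intro continuous_intros) (use len_pos in force)
  moreover have "sphere (0 :: real ^ 'v) 1 \<noteq> {}"
  proof -
    have "axis w 1 \<in> sphere (0 :: real ^ 'v) 1" by (simp add: norm_axis_1)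
    then show ?thesis by blast
  qed
  ultimately obtain \<phi>0 where \<phi>0: "norm \<phi>0 = 1" "\<And>\<phi>. norm \<phi> = 1 \<Longrightarrow> ?R \<phi>0 \<le> ?R \<phi>"
    using continuous_attains_inf[OF compact_sphere, of 0 1 ?R] by auto
  have "?R \<phi>0 \<noteq> 0"
  proof
    assume "?R \<phi>0 = 0"
    moreover have "0 \<le> (\<Sum>e\<in>arcs G. (difference \<phi>0 e)\<^sup>2 / (4 * len e))" by (intro sum_nonneg term0)
    moreover have "0 \<le> (\<phi>0 $ w)\<^sup>2" by simp
    ultimately have "(\<phi>0 $ w)\<^sup>2 = 0" and s: "(\<Sum>e\<in>arcs G. (difference \<phi>0 e)\<^sup>2 / (4 * len e)) = 0"
      by linarith+
    then have w0: "\<phi>0 $ w = 0" by simp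
    have "\<phi>0 $ head G e = \<phi>0 $ tail G e" if e: "e \<in> arcs G" for e
    proof -
      have "(difference \<phi>0 e)\<^sup>2 / (4 * len e) = 0"
        using s term0 e by (subst (asm) sum_nonneg_eq_0_iff) auto
      then show ?thesis using len_pos[OF e] by simp
    qed
    then have "\<phi>0 $ v = \<phi>0 $ w" for v by (rule constant_of_difference_zero)
    then have "\<phi>0 = 0" using w0 by (simp add: vec_eq_iff)
    then show False using \<phi>0(1) by simp
  qed
  moreover have "0 \<le> ?R \<phi>0" by (intro add_nonneg_nonneg sum_nonneg term0) auto
  ultimately have pos: "0 < ?R \<phi>0" by simp
  have "?R \<phi>0 * (norm \<phi>)\<^sup>2 \<le> ?R \<phi>" for \<phi>
  proof (cases "\<phi> = 0")
    case False
    define \<theta> where "\<theta> = \<phi> /\<^sub>R norm \<phi>"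
    have "norm \<theta> = 1" using False by (simp add: \<theta>_def)
    then have "?R \<phi>0 \<le> ?R \<theta>" by (rule \<phi>0(2))
    then have le: "?R \<phi>0 * (norm \<phi>)\<^sup>2 \<le> ?R \<theta> * (norm \<phi>)\<^sup>2" by (intro mult_right_mono) auto
    have "\<phi> $ v = \<theta> $ v * norm \<phi>" for v using False by (simp add: \<theta>_def)
    then have "?R \<phi> = (\<theta> $ w * norm \<phi>)\<^sup>2 + (\<Sum>e\<in>arcs G. (difference \<theta> e * norm \<phi>)\<^sup>2 / (4 * len e))"
      by (simp add: left_diff_distrib)
    also have "\<dots> = ?R \<theta> * (norm \<phi>)\<^sup>2"
      by (simp add: power_mult_distrib distrib_right sum_distrib_right)
    finally show ?thesis using le by simp
  qed simp
  with pos show ?thesis by (rule that)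
qed

text \<open>
  The staircase primitive dominates \<open>x\<^sup>2 / 2\<close>, so the energy is bounded below by the Dirichlet form up to
  terms of order at most one.
\<close>

lemma energy_coercive:
  obtains K b where "\<And>\<phi>. (\<Sum>e\<in>arcs G. (difference \<phi> e)\<^sup>2 / (4 * len e)) - b * norm \<phi> - K
    \<le> energy D \<phi> + q \<bullet> \<phi>" "0 \<le> b"
proof -
  define c where "c = (\<chi> v. of_int (D (Vertex v)) + (\<Sum>e\<in>in_arcs G v. real_of_int (edge_degree D e)))"
  define K where "K = (\<Sum>e\<in>arcs G. (edge_moment D e)\<^sup>2 / (2 * len e))"
  have "(\<Sum>e\<in>arcs G. (difference \<phi> e)\<^sup>2 / (4 * len e)) - norm (q - c) * norm \<phi> - K
    \<le> energy D \<phi> + q \<bullet> \<phi>" for \<phi>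
  proof -
    have "(difference \<phi> e)\<^sup>2 / (4 * len e) - (edge_moment D e)\<^sup>2 / (2 * len e)
        \<le> len e * staircase_primitive (mean_slope D \<phi> e)" if e: "e \<in> arcs G" for e
    proof -
      note L = len_pos[OF e]
      define a where "a = difference \<phi> e"
      define m where "m = edge_moment D e"
      \<comment> \<open>A lower bound for \<open>(a + m)\<^sup>2\<close> without mixed term: this square is twice the excess.\<close>
      have "0 \<le> (a + 2 * m)\<^sup>2" by simp
      then have "a\<^sup>2 / 2 - m\<^sup>2 \<le> (a + m)\<^sup>2" by (simp add: power2_eq_square algebra_simps)
      then have "(a\<^sup>2 / 2 - m\<^sup>2) / (2 * len e) \<le> (a + m)\<^sup>2 / (2 * len e)"
        using L by (intro divide_right_mono) auto
      also have "\<dots> = len e * ((mean_slope D \<phi> e)\<^sup>2 / 2)"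
        using L by (simp add: mean_slope_def a_def m_def power2_eq_square)
      also have "\<dots> \<le> len e * staircase_primitive (mean_slope D \<phi> e)"
        using L staircase_primitive_ge_square by (intro mult_left_mono) auto
      finally show ?thesis by (simp add: a_def m_def diff_divide_distrib)
    qed
    then have "(\<Sum>e\<in>arcs G. (difference \<phi> e)\<^sup>2 / (4 * len e)) - K
      \<le> (\<Sum>e\<in>arcs G. len e * staircase_primitive (mean_slope D \<phi> e))"
      unfolding K_def sum_subtractf[symmetric] by (intro sum_mono)
    moreover have "- (norm (q - c) * norm \<phi>) \<le> (q - c) \<bullet> \<phi>"
      using Cauchy_Schwarz_ineq2[of "q - c" \<phi>] by linarith
    moreover have "energy D \<phi> = (\<Sum>e\<in>arcs G. len e * staircase_primitive (mean_slope D \<phi> e)) - c \<bullet> \<phi>"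
      by (simp add: energy_def c_def inner_vec_def)
    ultimately show ?thesis by (simp add: inner_diff_left)
  qed
  then show ?thesis using that[of "norm (q - c)" K] by simp
qed

lemma isCont_energy: "isCont (\<lambda>\<phi>. energy D \<phi> + q \<bullet> \<phi>) \<phi>"
proof -
  have "isCont (\<lambda>\<phi>. mean_slope D \<phi> e) \<phi>" if "e \<in> arcs G" for e \<phi>
    unfolding mean_slope_def using len_pos[OF that] by (intro continuous_intros) auto
  then have "isCont (\<lambda>\<phi>. staircase_primitive (mean_slope D \<phi> e)) \<phi>" if "e \<in> arcs G" for e \<phi>
    using that by (intro isCont_o2[OF _ isCont_staircase_primitive]) auto
  then show ?thesis
    unfolding energy_def by (intro continuous_intros) auto
qed

text \<open>
  The energy is invariant under constants because \<open>q\<close> has the right total degree. So one may normalize the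
  potential at one vertex, and there the quadratic growth confines the search to a compact ball.
\<close>

lemma energy_minimizer_exists:
  assumes D: "D \<in> divisors G len" and q: "q \<in> hyperplane_deg (degree D)"
  obtains \<phi> where "\<forall>\<psi>. energy D \<phi> + q \<bullet> \<phi> \<le> energy D \<psi> + q \<bullet> \<psi>"
proof -
  define F where "F = (\<lambda>\<phi>. energy D \<phi> + q \<bullet> \<phi>)"
  \<comment> \<open>An arbitrary vertex at which potentials are normalized.\<close>
  define w :: 'v where "w = undefined"
  obtain m where m: "0 < m"
    "\<And>\<phi> :: real ^ 'v. m * (norm \<phi>)\<^sup>2 \<le> (\<phi> $ w)\<^sup>2 + (\<Sum>e\<in>arcs G. (difference \<phi> e)\<^sup>2 / (4 * len e))"
    using dirichlet_form_pos_def[of w] by blast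
  obtain K b where K: "\<And>\<phi>. (\<Sum>e\<in>arcs G. (difference \<phi> e)\<^sup>2 / (4 * len e)) - b * norm \<phi> - K \<le> F \<phi>" "0 \<le> b"
    unfolding F_def using energy_coercive[of D q] by blast
  \<comment> \<open>For \<open>norm \<psi> > r\<close> the lower bound \<open>m * (norm \<psi>)\<^sup>2 - b * norm \<psi> - K\<close> exceeds \<open>F 0\<close>.\<close>
  define r where "r = (b + \<bar>F 0 + K\<bar>) / m + 1"
  have r: "1 \<le> r" using m(1) K(2) by (simp add: r_def)
  define S where "S = cball 0 r \<inter> {\<phi> :: real ^ 'v. \<phi> $ w = 0}"
  have "compact S" unfolding S_def
    by (intro compact_Int_closed compact_cball closed_Collect_eq continuous_intros)
  moreover have "0 \<in> S" using r by (simp add: S_def)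
  moreover have "continuous_on S F"
    unfolding F_def by (intro continuous_at_imp_continuous_on ballI isCont_energy)
  ultimately obtain \<phi> where \<phi>: "\<phi> \<in> S" "\<And>\<psi>. \<psi> \<in> S \<Longrightarrow> F \<phi> \<le> F \<psi>"
    using continuous_attains_inf[of S F] by blast
  have slice: "F \<phi> \<le> F \<psi>" if w0: "\<psi> $ w = 0" for \<psi>
  proof (cases "norm \<psi> \<le> r")
    case True
    then show ?thesis using \<phi>(2) w0 by (simp add: S_def)
  next
    case False
    let ?x = "norm \<psi>"
    have x: "r < ?x" "1 \<le> ?x" using False r by auto
    have "m * r = b + \<bar>F 0 + K\<bar> + m" 
      unfolding r_def distrib_left using m(1) by simp
    then have "b + \<bar>F 0 + K\<bar> \<le> m * r" using m(1) by simp
    also have "\<dots> \<le> m * ?x" using x m(1) by simp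
    finally have "\<bar>F 0 + K\<bar> * 1 \<le> (m * ?x - b) * ?x"
      using x by (intro mult_mono) auto
    also have "\<dots> = m * ?x\<^sup>2 - b * ?x" by (simp add: power2_eq_square algebra_simps)
    finally have "F 0 \<le> F \<psi>" using m(2)[of \<psi>] K(1)[of \<psi>] w0 by simp
    then show ?thesis using \<phi>(2)[OF \<open>0 \<in> S\<close>] by linarith
  qed
  have "F \<phi> \<le> F \<psi>" for \<psi>
  proof -
    have "F \<phi> \<le> F (\<psi> + (\<chi> v. - (\<psi> $ w)))" by (rule slice) simp
    also have "\<dots> = F \<psi>" unfolding F_def by (rule energy_shift_const[OF D q])
    finally show ?thesis .
  qed
  then show ?thesis using that unfolding F_def by blast
qed

end

section \<open>Rational divisors in every cell\<close>

lemma real_add_subgroup_add: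
  "real_add_subgroup \<Lambda> \<Longrightarrow> x \<in> \<Lambda> \<Longrightarrow> y \<in> \<Lambda> \<Longrightarrow> x + y \<in> \<Lambda>"
  unfolding real_add_subgroup_def by blast

lemma real_add_subgroup_diff:
  "real_add_subgroup \<Lambda> \<Longrightarrow> x \<in> \<Lambda> \<Longrightarrow> y \<in> \<Lambda> \<Longrightarrow> x - y \<in> \<Lambda>"
  unfolding real_add_subgroup_def by (metis uminus_add_conv_diff add.commute)

lemma real_add_subgroup_mult:
  assumes "real_add_subgroup \<Lambda>" "x \<in> \<Lambda>"
  shows "of_int k * x \<in> \<Lambda>"
proof -
  have nat: "of_nat n * x \<in> \<Lambda>" for n
    using assms by (induction n) (auto simp: real_add_subgroup_def algebra_simps)
  show ?thesis
  proof (cases k rule: int_cases2)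
    case (nonneg n)
    then show ?thesis using nat[of n] by simp
  next
    case (nonpos n)
    then show ?thesis using nat[of n] assms(1) by (simp add: real_add_subgroup_def)
  qed
qed

text \<open>
  Simultaneous approximation that keeps all differences which already lie in \<open>\<Lambda>\<close>: the indices fall into classes
  modulo \<open>\<Lambda>\<close>, one representative of each class is moved into \<open>\<Lambda>\<close>, and the rest of the class moves along with
  it.
\<close>

lemma dense_subgroup_approximation:
  fixes k :: "'v::finite \<Rightarrow> real"
  assumes \<Lambda>: "real_add_subgroup \<Lambda>" "closure \<Lambda> = UNIV" and "0 < \<epsilon>"
  obtains k' where "\<And>v. k' v \<in> \<Lambda>" "\<And>v. \<bar>k' v - k v\<bar> < \<epsilon>"
    "\<And>u v. k v - k u \<in> \<Lambda> \<Longrightarrow> k' v - k' u = k v - k u"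
proof -
  define rep where "rep v = (SOME u. k v - k u \<in> \<Lambda>)" for v
  have rep: "k v - k (rep v) \<in> \<Lambda>" for v
    unfolding rep_def
    by (rule someI[of "\<lambda>u. k v - k u \<in> \<Lambda>" v]) (use \<Lambda>(1) in \<open>simp add: real_add_subgroup_def\<close>)
  have rep_eq: "rep v = rep u" if "k v - k u \<in> \<Lambda>" for u v
  proof -
    have "k v - k w \<in> \<Lambda> \<longleftrightarrow> k u - k w \<in> \<Lambda>" for w
    proof
      assume "k v - k w \<in> \<Lambda>"
      from real_add_subgroup_diff[OF \<Lambda>(1) this that] show "k u - k w \<in> \<Lambda>" by simp
    next
      assume "k u - k w \<in> \<Lambda>"
      then have "(k v - k u) + (k u - k w) \<in> \<Lambda>"
        using that \<Lambda>(1) by (intro real_add_subgroup_add)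
      then show "k v - k w \<in> \<Lambda>" by simp
    qed
    then show ?thesis by (simp add: rep_def)
  qed
  have "\<exists>l\<in>\<Lambda>. dist l x < \<epsilon>" for x
    using \<Lambda>(2) \<open>0 < \<epsilon>\<close> by (metis UNIV_I closure_approachable)
  then obtain l where l: "\<And>x. l x \<in> \<Lambda>" "\<And>x. dist (l x) x < \<epsilon>" by metis
  show ?thesis
  proof
    show "l (k (rep v)) + (k v - k (rep v)) \<in> \<Lambda>" for v
      using rep[of v] l(1) \<Lambda>(1) by (intro real_add_subgroup_add)
    show "\<bar>l (k (rep v)) + (k v - k (rep v)) - k v\<bar> < \<epsilon>" for v
      using l(2)[of "k (rep v)"] by (simp add: dist_real_def algebra_simps)
    show "l (k (rep v)) + (k v - k (rep v)) - (l (k (rep u)) + (k u - k (rep u))) = k v - k u"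
      if "k v - k u \<in> \<Lambda>" for u v
      using rep_eq[OF that] by simp
  qed
qed

context graph_model
begin

lemma edge_moment_in_subgroup:
  assumes "real_add_subgroup \<Lambda>" "D \<in> divisors G len" "rational_over G len \<Lambda> D" "e \<in> arcs G"
  shows "edge_moment D e \<in> \<Lambda>"
proof -
  have mem: "of_int (D (Interior e s)) * (len e - s) \<in> \<Lambda>" if "s \<in> interior_support D e" for s
  proof -
    have "edge_point G len e s = Interior e s" "s \<in> {0..len e}" "Interior e s \<in> supp D"
      using that by (auto simp: interior_support_def edge_point_def supp_def)
    then have "len e - s \<in> \<Lambda>" using assms(3,4) unfolding rational_over_def by metis
    then show ?thesis by (rule real_add_subgroup_mult[OF assms(1)])
  qed
  have "(\<Sum>s\<in>S. of_int (D (Interior e s)) * (len e - s)) \<in> \<Lambda>" if "finite S" "S \<subseteq> interior_support D e" for S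
    using that mem assms(1) by (induction S rule: finite_induct) (auto simp: real_add_subgroup_def)
  then show ?thesis
    unfolding edge_moment_def using finite_interior_support[OF assms(2)] by blast
qed

text \<open>
  The interior point has distance \<open>len e * frac y\<close> to the head, and this differs from \<open>len e * y\<close> by an integral
  multiple of the edge length.
\<close>

lemma admissible_rep_rational:
  assumes \<Lambda>: "real_add_subgroup \<Lambda>" and len: "\<forall>e\<in>arcs G. len e \<in> \<Lambda>"
    and m: "\<And>e. e \<in> arcs G \<Longrightarrow> len e * mean_slope D \<phi> e \<in> \<Lambda>"
  shows "rational_over G len \<Lambda> (admissible_rep D \<phi>)"
  unfolding rational_over_def
proof (intro ballI impI)
  fix e t assume e: "e \<in> arcs G" and t: "t \<in> {0..len e}"
    and supp: "edge_point G len e t \<in> supp (admissible_rep D \<phi>)"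
  let ?y = "mean_slope D \<phi> e"
  have L: "len e \<in> \<Lambda>" and 0: "0 \<in> \<Lambda>" using len e \<Lambda> by (auto simp: real_add_subgroup_def)
  consider "t = 0" | "t = len e" | "t \<noteq> 0" "t \<noteq> len e" by blast
  then show "t \<in> \<Lambda> \<and> len e - t \<in> \<Lambda>"
  proof cases
    case 3
    then have "t = len e * (1 - frac ?y)"
      using supp e by (auto simp: edge_point_def supp_def admissible_rep_Interior split: if_splits)
    then have "len e - t = len e * ?y - of_int \<lfloor>?y\<rfloor> * len e"
      by (simp add: frac_def algebra_simps)
    then have "len e - t \<in> \<Lambda>"
      using real_add_subgroup_diff[OF \<Lambda> m[OF e] real_add_subgroup_mult[OF \<Lambda> L]] by simp
    then show ?thesis using real_add_subgroup_diff[OF \<Lambda> L, of "len e - t"] by simp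
  qed (use L 0 in auto)
qed

text \<open>
  Measured relative to the potential of one divisor rational over \<open>\<Lambda>\<close>, the potentials with values in \<open>\<Lambda>\<close>
  give divisors rational over \<open>\<Lambda>\<close>. A cell is given by equations on the edges of integral mean slope, which force
  the relative difference along the edge to lie in \<open>\<Lambda>\<close> and so survive the approximation, and by strict
  inequalities on the other edges, which survive if the approximation is good enough.
\<close>

lemma rational_potential_in_cell:
  assumes \<Lambda>: "real_add_subgroup \<Lambda>" "closure \<Lambda> = UNIV" and len: "\<forall>e\<in>arcs G. len e \<in> \<Lambda>"
    and D: "D \<in> divisors G len" and D': "(D, D') \<in> lin_equiv G len" "rational_over G len \<Lambda> D'"
  obtains \<psi> where "rational_over G len \<Lambda> (admissible_rep D \<psi>)"
    "\<forall>e\<in>arcs G. \<lfloor>mean_slope D \<psi> e\<rfloor> = \<lfloor>mean_slope D \<phi> e\<rfloor>"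
    "\<forall>e\<in>arcs G. \<lceil>mean_slope D \<psi> e\<rceil> = \<lceil>mean_slope D \<phi> e\<rceil>"
proof -
  obtain f where D'd: "D' \<in> divisors G len" and f: "rational_function G len f"
    and div: "\<And>x. D x - D' x = div_of G len f x"
    using D'(1) unfolding lin_equiv_def by blast
  define \<phi>0 where "\<phi>0 = (\<chi> v. f (Vertex v))"
  define k where "k = (\<lambda>v. \<phi> $ v - \<phi>0 $ v)"
  define y where "y = mean_slope D \<phi>"
  have base: "len e * mean_slope D \<phi>0 e \<in> \<Lambda>" if e: "e \<in> arcs G" for e
  proof -
    obtain r where "f (Vertex (head G e)) - f (Vertex (tail G e)) = of_int r * len e + edge_moment D' e - edge_moment D e"
      using edge_slopes(2)[OF e f D D'd div] by blast
    then have "len e * mean_slope D \<phi>0 e = of_int r * len e + edge_moment D' e"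
      using len_pos[OF e] by (simp add: mean_slope_def \<phi>0_def)
    moreover have "edge_moment D' e \<in> \<Lambda>"
      by (rule edge_moment_in_subgroup[OF \<Lambda>(1) D'd D'(2) e])
    ultimately show ?thesis
      using real_add_subgroup_add[OF \<Lambda>(1) real_add_subgroup_mult[OF \<Lambda>(1), of "len e" r]] len e by simp
  qed
  \<comment> \<open>Half the distance to the boundary of the cell, since both ends of the edge are perturbed.\<close>
  define d where "d = (\<lambda>e. if y e \<in> \<int> then 1 else min (frac (y e)) (1 - frac (y e)) * len e / 2)"
  have dpos: "0 < d e" if "e \<in> arcs G" for e
    using len_pos[OF that] frac_lt_1[of "y e"] by (auto simp: d_def frac_gt_0_iff)
  \<comment> \<open>The \<open>1\<close> only keeps the set nonempty for a graph without edges.\<close>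
  define \<epsilon> where "\<epsilon> = Min (insert 1 (d ` arcs G))"
  have "0 < \<epsilon>" unfolding \<epsilon>_def using dpos by (subst Min_gr_iff) auto
  have \<epsilon>: "\<epsilon> \<le> d e" if "e \<in> arcs G" for e unfolding \<epsilon>_def using that by (intro Min_le) auto
  obtain k' where k': "\<And>v. k' v \<in> \<Lambda>" "\<And>v. \<bar>k' v - k v\<bar> < \<epsilon>"
    "\<And>u v. k v - k u \<in> \<Lambda> \<Longrightarrow> k' v - k' u = k v - k u"
    using dense_subgroup_approximation[OF \<Lambda> \<open>0 < \<epsilon>\<close>, of k] by blast
  define \<psi> where "\<psi> = (\<chi> v. \<phi>0 $ v + k' v)"
  have \<psi>: "len e * mean_slope D \<psi> e = len e * mean_slope D \<phi>0 e + (k' (head G e) - k' (tail G e))"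
    and \<phi>: "len e * y e = len e * mean_slope D \<phi>0 e + (k (head G e) - k (tail G e))" if "e \<in> arcs G" for e
    using len_pos[OF that] by (simp_all add: mean_slope_def \<psi>_def y_def k_def)
  have cell: "\<lfloor>mean_slope D \<psi> e\<rfloor> = \<lfloor>y e\<rfloor> \<and> \<lceil>mean_slope D \<psi> e\<rceil> = \<lceil>y e\<rceil>" if e: "e \<in> arcs G" for e
  proof (cases "y e \<in> \<int>")
    case True
    then obtain n where "y e = of_int n" by (elim Ints_cases)
    then have "len e * y e \<in> \<Lambda>"
      using real_add_subgroup_mult[OF \<Lambda>(1), of "len e" n] len e by (simp add: mult.commute)
    then have "k (head G e) - k (tail G e) \<in> \<Lambda>"
      using real_add_subgroup_diff[OF \<Lambda>(1) \<open>len e * y e \<in> \<Lambda>\<close> base[OF e]] \<phi>[OF e] by simp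
    then have "len e * mean_slope D \<psi> e = len e * y e"
      using k'(3) \<psi>[OF e] \<phi>[OF e] by simp
    then show ?thesis using len_pos[OF e] by simp
  next
    case False
    have L: "0 < len e" using e by (rule len_pos)
    have "\<bar>len e * mean_slope D \<psi> e - len e * y e\<bar> < 2 * \<epsilon>"
      using \<psi>[OF e] \<phi>[OF e] k'(2)[of "head G e"] k'(2)[of "tail G e"] by linarith
    also have "2 * \<epsilon> \<le> len e * min (frac (y e)) (1 - frac (y e))"
      using \<epsilon>[OF e] False by (simp add: d_def mult.commute)
    finally have "len e * \<bar>mean_slope D \<psi> e - y e\<bar> < len e * min (frac (y e)) (1 - frac (y e))"
      using L by (simp add: right_diff_distrib[symmetric] abs_mult)
    then have "\<bar>mean_slope D \<psi> e - y e\<bar> < min (frac (y e)) (1 - frac (y e))"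
      using L by (simp only: mult_less_cancel_left_pos)
    then have "of_int \<lfloor>y e\<rfloor> < mean_slope D \<psi> e" "mean_slope D \<psi> e < of_int \<lfloor>y e\<rfloor> + 1"
      unfolding frac_def by linarith+
    moreover from this have "\<lceil>mean_slope D \<psi> e\<rceil> = \<lfloor>y e\<rfloor> + 1" by (simp add: ceiling_eq_iff)
    ultimately show ?thesis
      using ceiling_eq_floor_add_one[OF False] by (simp add: floor_eq_iff)
  qed
  show ?thesis
  proof
    show "rational_over G len \<Lambda> (admissible_rep D \<psi>)"
    proof (rule admissible_rep_rational[OF \<Lambda>(1) len])
      fix e assume e: "e \<in> arcs G"
      show "len e * mean_slope D \<psi> e \<in> \<Lambda>"
        unfolding \<psi>[OF e]
        by (intro real_add_subgroup_add real_add_subgroup_diff \<Lambda>(1) base[OF e] k'(1))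
    qed
  qed (use cell y_def in auto)
qed

section \<open>The tiling\<close>

text \<open>
  The right-hand side does not mention \<open>\<Lambda>\<close>, which is the asserted independence.
\<close>

lemma semistability_polytopes_eq_range:
  assumes D: "D \<in> divisors G len"
    and \<Lambda>: "real_add_subgroup \<Lambda>" "closure \<Lambda> = UNIV" and len: "\<forall>e\<in>arcs G. len e \<in> \<Lambda>"
    and ex: "\<exists>D'\<in>lin_equiv G len `` {D}. rational_over G len \<Lambda> D'"
  shows "semistability_polytopes G len (lin_equiv G len `` {D}) \<Lambda>
    = range (\<lambda>\<phi>. semistability_polytope G len (admissible_rep D \<phi>))"
proof (intro equalityI subsetI)
  fix P assume "P \<in> semistability_polytopes G len (lin_equiv G len `` {D}) \<Lambda>"
  then obtain D' where P: "P = semistability_polytope G len D'"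
    and "D' \<in> {D' \<in> lin_equiv G len `` {D}. G_admissible G len D'}"
    unfolding semistability_polytopes_def by blast
  then obtain \<phi> where "D' = admissible_rep D \<phi>"
    unfolding admissible_class_eq_range[OF D] by blast
  then show "P \<in> range (\<lambda>\<phi>. semistability_polytope G len (admissible_rep D \<phi>))"
    using P by blast
next
  fix P assume "P \<in> range (\<lambda>\<phi>. semistability_polytope G len (admissible_rep D \<phi>))"
  then obtain \<phi> where P: "P = semistability_polytope G len (admissible_rep D \<phi>)" by blast
  obtain D' where "(D, D') \<in> lin_equiv G len" "rational_over G len \<Lambda> D'" using ex by blast
  from rational_potential_in_cell[OF \<Lambda> len D this, of \<phi>]
  obtain \<psi> where \<psi>: "rational_over G len \<Lambda> (admissible_rep D \<psi>)"
    "\<forall>e\<in>arcs G. \<lfloor>mean_slope D \<psi> e\<rfloor> = \<lfloor>mean_slope D \<phi> e\<rfloor>"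
    "\<forall>e\<in>arcs G. \<lceil>mean_slope D \<psi> e\<rceil> = \<lceil>mean_slope D \<phi> e\<rceil>" .
  have "P = semistability_polytope G len (admissible_rep D \<psi>)"
    unfolding P by (rule semistability_polytope_cong[OF D, symmetric]) (use \<psi> in auto)
  moreover have "admissible_rep D \<psi> \<in> {D' \<in> lin_equiv G len `` {D}. G_admissible G len D'}"
    unfolding admissible_class_eq_range[OF D] by blast
  ultimately show "P \<in> semistability_polytopes G len (lin_equiv G len `` {D}) \<Lambda>"
    unfolding semistability_polytopes_def using \<psi>(1) by blast
qed

lemma polytope_tiling_semistability_polytopes:
  assumes D: "D \<in> divisors G len"
  shows "polytope_tiling (range (\<lambda>\<phi>. semistability_polytope G len (admissible_rep D \<phi>)))
    (hyperplane_deg (degree D))"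
  unfolding polytope_tiling_def
proof (intro conjI)
  let ?P = "\<lambda>\<phi>. semistability_polytope G len (admissible_rep D \<phi>)"
  show "\<forall>P\<in>range ?P. polytope P" using polytope_semistability_polytope by blast
  show "\<Union>(range ?P) = hyperplane_deg (degree D)"
  proof (intro equalityI subsetI)
    fix q :: "real ^ 'v" assume q: "q \<in> hyperplane_deg (degree D)"
    obtain \<phi> where "\<forall>\<psi>. energy D \<phi> + q \<bullet> \<phi> \<le> energy D \<psi> + q \<bullet> \<psi>"
      by (rule energy_minimizer_exists[OF D q])
    then have "q \<in> ?P \<phi>" using q by (simp add: mem_semistability_polytope_iff_minimal[OF D])
    then show "q \<in> \<Union>(range ?P)" by blast
  next
    fix q assume "q \<in> \<Union>(range ?P)"
    then obtain \<phi> where "q \<in> ?P \<phi>" by blast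
    then show "q \<in> hyperplane_deg (degree D)" by (simp add: mem_semistability_polytope_iff_minimal[OF D])
  qed
  have "?P \<phi> \<inter> ?P \<psi> face_of ?P \<phi>" "?P \<phi> \<inter> ?P \<psi> face_of ?P \<psi>" for \<phi> \<psi>
    using semistability_polytopes_meet_in_face[OF D, of \<phi> \<psi>]
      semistability_polytopes_meet_in_face[OF D, of \<psi> \<phi>] by (simp_all add: Int_commute)
  then show "\<forall>P\<in>range ?P. \<forall>Q\<in>range ?P. P \<inter> Q = {} \<or> P \<inter> Q face_of P \<and> P \<inter> Q face_of Q"
    by blast
qed

end

theorem theorem6p2:
  fixes G :: "('v::finite, 'e) pre_digraph"
    and len :: "'e \<Rightarrow> real"
    and \<D> :: "(('v, 'e) point \<Rightarrow> int) set"
    and d :: int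
    and \<Lambda> :: "real set"
  assumes "metric_graph_model G len"
    and "\<D> \<in> {D \<in> divisors G len. degree D = d} // lin_equiv G len"
    and "real_add_subgroup \<Lambda>"
    and "\<forall>e\<in>arcs G. len e \<in> \<Lambda>"
    and "\<exists>D\<in>\<D>. rational_over G len \<Lambda> D"
    and "closure \<Lambda> = UNIV"
  shows "polytope_tiling (semistability_polytopes G len \<D> \<Lambda>) (hyperplane_deg d) \<and>
    (\<forall>\<Lambda>'. real_add_subgroup \<Lambda>' \<and> (\<forall>e\<in>arcs G. len e \<in> \<Lambda>') \<and>
           (\<exists>D\<in>\<D>. rational_over G len \<Lambda>' D) \<and> closure \<Lambda>' = UNIV \<longrightarrow>
       semistability_polytopes G len \<D> \<Lambda>' = semistability_polytopes G len \<D> \<Lambda>)"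
proof -
  interpret graph_model G len by unfold_locales (rule assms(1))
  obtain D where D: "D \<in> divisors G len" "degree D = d" and \<D>: "\<D> = lin_equiv G len `` {D}"
    using assms(2) by (auto elim: quotientE)
  show ?thesis
    using polytope_tiling_semistability_polytopes[OF D(1)] semistability_polytopes_eq_range[OF D(1)]
      assms(3-6) D(2) by (simp add: \<D>)
qed

end
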